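(* Let $\mathbb{F}$ be an arbitrary field, let $t,n\ge1$ be integers, let $\sigma\in\{1,-1\}$, let $\lambda B+A$ be a pencil of size $(t+1)n\times(t+1)n$ over $\mathbb{F}$, and let $$\mathcal{L}(\lambda)=\begin{bmatrix}\lambda B+A&\widehat{L}_t(\lambda)^T\otimes I_n\\ \sigma\widehat{L}_t(\lambda)\otimes I_n&0\end{bmatrix}.$$ If $$(\widehat{\Lambda}_t(\lambda)^T\otimes I_n)(\lambda B+A)(\widehat{\Lambda}_t(\lambda)\otimes I_n)=\begin{bmatrix}-P&\lambda^tP\\ \lambda^tP&Q(\lambda)\end{bmatrix}$$ for some nonsingular matrix $P\in\mathbb{F}^{n\times n}$ and some matrix polynomial $Q(\lambda)\in\mathbb{F}[\lambda]^{n\times n}$ of grade $2t-1$, then $\mathcal{L}(\lambda)$ is a strong linearization of the grade-$2t$ matrix polynomial $P(\lambda):=\lambda^{2t}P+Q(\lambda)$.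
   Context: $\widehat{L}_k(\lambda)\in\mathbb{F}[\lambda]^{(k-1)\times(k+1)}$ is the matrix whose first column is zero and whose $(i,i+1)$ entries are $-1$ and $(i,i+2)$ entries are $\lambda$ ($i=1,\dots,k-1$), all other entries being zero (for $k=1$ it is an empty $0\times 2$ matrix). $\widehat{\Lambda}_k(\lambda)^T=\begin{bmatrix}1&0&\cdots&0&0\\0&\lambda^{k-1}&\cdots&\lambda&1\end{bmatrix}\in\mathbb{F}[\lambda]^{2\times(k+1)}$. A matrix polynomial has grade $g$ if it is regarded as $\sum_{k=0}^gQ_k\lambda^k$ with possibly zero leading coefficients (so its degree is at most $g$). $\mathrm{rev}_gP(\lambda)=\lambda^gP(\lambda^{-1})$. A pencil $L(\lambda)=\lambda X+Y$ is a linearization of $P(\lambda)$ if there exist unimodular matrix polynomials $U(\lambda),V(\lambda)$ with $U(\lambda)L(\lambda)V(\lambda)=\mathrm{diag}(I_m,P(\lambda))$ for some natural number $m$; it is a strong linearization of $P(\lambda)$ of grade $g$ if in addition $\mathrm{rev}_1L(\lambda)=\lambda Y+X$ is a linearization of $\mathrm{rev}_gP(\lambda)$. *)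

theory Defs
  imports "Jordan_Normal_Form.Determinant"
begin

text \<open>
  Matrix polynomials in $F[\lambda]^{p \times q}$ are elements of type \<open>'a poly mat\<close>;
  row and column indices start at 0.
\<close>

definition const_mat :: "'a :: zero mat \<Rightarrow> 'a poly mat" where
  "const_mat M = map_mat (\<lambda>c. [:c:]) M"

text \<open>\<open>pencil X Y\<close> is $\lambda X + Y$.\<close>

definition pencil :: "'a :: comm_semiring_1 mat \<Rightarrow> 'a mat \<Rightarrow> 'a poly mat" where
  "pencil X Y = monom 1 1 \<cdot>\<^sub>m const_mat X + const_mat Y"

definition kronecker_mat :: "'a :: times mat \<Rightarrow> 'a mat \<Rightarrow> 'a mat" (infixl \<open>\<otimes>\<^sub>K\<close> 72) where
  "M \<otimes>\<^sub>K N = mat (dim_row M * dim_row N) (dim_col M * dim_col N)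
     (\<lambda>(i, j). M $$ (i div dim_row N, j div dim_col N) * N $$ (i mod dim_row N, j mod dim_col N))"

definition L_hat :: "nat \<Rightarrow> 'a :: comm_ring_1 poly mat" where
  "L_hat k = mat (k - 1) (k + 1)
     (\<lambda>(i, j). if j = i + 1 then - 1 else if j = i + 2 then monom 1 1 else 0)"

text \<open>
  The $(k+1) \times 2$ matrix with columns $(1, 0, \ldots, 0)$ and
  $(0, \lambda^{k-1}, \ldots, \lambda, 1)$.
\<close>

definition Lambda_hat :: "nat \<Rightarrow> 'a :: comm_semiring_1 poly mat" where
  "Lambda_hat k = mat (k + 1) 2
     (\<lambda>(i, j). if j = 0 then (if i = 0 then 1 else 0)
              else (if i = 0 then 0 else monom 1 (k - i)))"

definition has_grade :: "nat \<Rightarrow> 'a :: zero poly mat \<Rightarrow> bool" where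
  "has_grade g M \<longleftrightarrow> (\<forall>i < dim_row M. \<forall>j < dim_col M. degree (M $$ (i, j)) \<le> g)"

text \<open>
  The reversal $\lambda^g p(\lambda^{-1})$ with respect to the grade \<open>g\<close>, meaningful for
  \<open>degree p \<le> g\<close>. It differs from \<^const>\<open>reflect_poly\<close> by the factor
  $\lambda^{g - \deg p}$.
\<close>

definition rev_poly :: "nat \<Rightarrow> 'a :: comm_monoid_add poly \<Rightarrow> 'a poly" where
  "rev_poly g p = (\<Sum>k\<le>g. monom (coeff p k) (g - k))"

lemma poly_rev_poly:
  fixes p :: "'a :: field poly"
  assumes "degree p \<le> g" and "x \<noteq> 0"
  shows "poly (rev_poly g p) x = x ^ g * poly p (inverse x)"
proof -
  have "poly p (inverse x) = (\<Sum>k\<le>g. coeff p k * inverse x ^ k)"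
    unfolding poly_altdef using assms(1)
    by (intro sum.mono_neutral_left) (auto simp: coeff_eq_0)
  then show ?thesis
    using assms(2)
    by (auto simp: rev_poly_def poly_sum poly_monom sum_distrib_left power_diff
        field_simps intro!: sum.cong)
qed

definition rev_mat :: "nat \<Rightarrow> 'a :: comm_monoid_add poly mat \<Rightarrow> 'a poly mat" where
  "rev_mat g M = map_mat (rev_poly g) M"

lemma rev_mat_pencil:
  assumes "X \<in> carrier_mat r s" and "Y \<in> carrier_mat r s"
  shows "rev_mat 1 (pencil X Y) = pencil Y X"
  using assms
  by (intro eq_matI)
     (auto simp: rev_mat_def pencil_def const_mat_def rev_poly_def poly_eq_iff
       coeff_pCons monom_altdef split: nat.splits)

definition unimodular :: "'a :: comm_ring_1 poly mat \<Rightarrow> bool" where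
  "unimodular U \<longleftrightarrow> square_mat U \<and> (\<exists>c. c \<noteq> 0 \<and> det U = [:c:])"

definition linearization :: "'a :: field poly mat \<Rightarrow> 'a poly mat \<Rightarrow> bool" where
  "linearization L P \<longleftrightarrow> has_grade 1 L \<and>
     (\<exists>m U V. U \<in> carrier_mat (dim_row L) (dim_row L) \<and> unimodular U \<and>
        V \<in> carrier_mat (dim_col L) (dim_col L) \<and> unimodular V \<and>
        U * L * V = diag_block_mat [1\<^sub>m m, P])"

definition strong_linearization :: "'a :: field poly mat \<Rightarrow> nat \<Rightarrow> 'a poly mat \<Rightarrow> bool" where
  "strong_linearization L g P \<longleftrightarrow> has_grade g P \<and>
     linearization L P \<and> linearization (rev_mat 1 L) (rev_mat g P)"

end

theory Submission
  imports Defs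
begin

text \<open>
  Complete the columns of $\widehat\Lambda_t$ to a unimodular $W$ with
  $\widehat L_t W = [0 \mid I_{t-1}]$. The congruence by $W \otimes I_n$ turns the identity blocks of
  the bordered pencil into pivots, which reduce it to
  $(\widehat\Lambda_t^T \otimes I_n)(\lambda B + A)(\widehat\Lambda_t \otimes I_n) \oplus I$.
  Since $P$ is invertible, the Schur complement of the block $-P$ is
  $Q + \lambda^t P P^{-1} \lambda^t P = P(\lambda)$.

  Reversal multiplies the second column of $\widehat\Lambda_t(\lambda^{-1})$ by $\lambda^{t-1}$, so the
  $2 \times 2$ block matrix becomes $-\lambda P$, $P$, $P$, $\mathrm{rev}_{2t-1} Q$. Now $P$ is an invertible
  off-diagonal block, with Schur complement $P + \lambda\, \mathrm{rev}_{2t-1} Q = \mathrm{rev}_{2t} P(\lambda)$.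
\<close>

section \<open>Unimodular equivalence\<close>

text \<open>The two halves of the statement cannot in general share one completion. If a square
  polynomial matrix has constant determinant c, reversing its columns with grades d_j turns the
  determinant into c lambda^s, s the sum of the d_j, so unimodularity is usually lost. The reversed
  pencil therefore gets a completion of its own, and whatever the two halves share is stated for
  abstract \<open>K\<close>, \<open>\<Lambda>\<close> and a pair of matrices of size t + 1 with
  \<open>e * w = 1\<close>. This one identity, independent of n, carries the argument: it makes
  \<open>w\<close> unimodular without computing a determinant, and because the lower rows of
  \<open>e\<close> are those of \<open>K\<close>, it also gives K w = [0 | I]. Tensoring with I_n
  only enlarges the blocks. The number 2t - 1 comes from grading the two columns of the dual basis
  separately, by 0 and t - 1: with the grade 1 of the pencil, the four compressed blocks get grades
  1, t, t and 2t - 1.\<close>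

lemma unimodular_if_inverse:
  fixes U V :: "'a :: field poly mat"
  assumes U: "U \<in> carrier_mat r r" and V: "V \<in> carrier_mat r r" and UV: "U * V = 1\<^sub>m r"
  shows "unimodular U" and "unimodular V"
proof -
  have one: "det U * det V = 1"
    using det_mult[OF U V] UV by simp
  then have "det U dvd 1" "det V dvd 1"
    by (metis dvd_triv_left, metis dvd_triv_right)
  then show "unimodular U" "unimodular V"
    using U V by (auto simp: unimodular_def is_unit_poly_iff)
qed

lemma unimodular_mult:
  fixes U V :: "'a :: field poly mat"
  assumes U: "U \<in> carrier_mat r r" "unimodular U" and V: "V \<in> carrier_mat r r" "unimodular V"
  shows "unimodular (U * V)"
proof -
  obtain c d where "c \<noteq> 0" "det U = [:c:]" "d \<noteq> 0" "det V = [:d:]"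
    using U(2) V(2) by (auto simp: unimodular_def)
  then have "c * d \<noteq> 0 \<and> det (U * V) = [:c * d:]"
    using det_mult[OF U(1) V(1)] by simp
  then show ?thesis
    using U(1) V(1) unfolding unimodular_def by auto
qed

lemma unimodular_transpose:
  assumes "U \<in> carrier_mat r r" "unimodular U"
  shows "unimodular (transpose_mat U)"
  using assms det_transpose[OF assms(1)] by (simp add: unimodular_def)

lemma unimodular_one: "unimodular (1\<^sub>m r)"
  unfolding unimodular_def by (auto intro!: exI[of _ 1])

lemma unimodular_diag:
  fixes U V :: "'a :: field poly mat"
  assumes U: "U \<in> carrier_mat r r" "unimodular U" and V: "V \<in> carrier_mat s s" "unimodular V"
  shows "unimodular (four_block_mat U (0\<^sub>m r s) (0\<^sub>m s r) V)"
proof -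
  obtain c d where "c \<noteq> 0" "det U = [:c:]" "d \<noteq> 0" "det V = [:d:]"
    using U(2) V(2) by (auto simp: unimodular_def)
  then have "c * d \<noteq> 0 \<and> det (four_block_mat U (0\<^sub>m r s) (0\<^sub>m s r) V) = [:c * d:]"
    using det_four_block_mat_lower_left_zero[OF U(1) _ refl V(1)] by simp
  then show ?thesis
    using U(1) V(1) unfolding unimodular_def by auto
qed

text \<open>Shaped like the existential in \<open>linearization\<close>, but with an arbitrary
  target, so that reductions can be chained. The sizes of \<open>U\<close> and \<open>V\<close> are
  read off \<open>X\<close>, which forces \<open>Y\<close> to have the same size.\<close>

definition unimod_equiv :: "'a :: field poly mat \<Rightarrow> 'a poly mat \<Rightarrow> bool" where
  "unimod_equiv X Y \<longleftrightarrow> (\<exists>U V.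
     U \<in> carrier_mat (dim_row X) (dim_row X) \<and> unimodular U \<and>
     V \<in> carrier_mat (dim_col X) (dim_col X) \<and> unimodular V \<and> U * X * V = Y)"

lemma unimod_equivI:
  assumes "X \<in> carrier_mat r s"
    and "U \<in> carrier_mat r r" "unimodular U"
    and "V \<in> carrier_mat s s" "unimodular V"
    and "U * X * V = Y"
  shows "unimod_equiv X Y"
  using assms unfolding unimod_equiv_def by (intro exI[of _ U] exI[of _ V]) auto

lemma unimod_equivE:
  assumes "unimod_equiv X Y" and "X \<in> carrier_mat r s"
  obtains U V where "U \<in> carrier_mat r r" "unimodular U" "V \<in> carrier_mat s s" "unimodular V"
    "U * X * V = Y"
  using assms unfolding unimod_equiv_def by auto

lemma unimod_equiv_trans [trans]:
  assumes "unimod_equiv X Y" and "unimod_equiv Y Z"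
  shows "unimod_equiv X Z"
proof -
  have X: "X \<in> carrier_mat (dim_row X) (dim_col X)" by simp
  obtain U V where UV: "U \<in> carrier_mat (dim_row X) (dim_row X)" "unimodular U"
      "V \<in> carrier_mat (dim_col X) (dim_col X)" "unimodular V" "U * X * V = Y"
    using unimod_equivE[OF assms(1) X] by metis
  have Y: "Y \<in> carrier_mat (dim_row X) (dim_col X)"
    using UV by auto
  obtain U' V' where UV': "U' \<in> carrier_mat (dim_row X) (dim_row X)" "unimodular U'"
      "V' \<in> carrier_mat (dim_col X) (dim_col X)" "unimodular V'" "U' * Y * V' = Z"
    using unimod_equivE[OF assms(2) Y] by metis
  have UX: "U * X \<in> carrier_mat (dim_row X) (dim_col X)"
    by (rule mult_carrier_mat[OF UV(1) X])
  have "U' * (U * X * V) * V' = U' * (U * X) * (V * V')"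
    unfolding assoc_mult_mat[OF UV'(1) UX UV(3), symmetric]
    by (rule assoc_mult_mat[OF mult_carrier_mat[OF UV'(1) UX] UV(3) UV'(3)])
  then have "(U' * U) * X * (V * V') = Z"
    using assoc_mult_mat[OF UV'(1) UV(1) X] unfolding UV(5) UV'(5) by simp
  then show ?thesis
    using UV UV' by (intro unimod_equivI[OF X]) (auto intro: unimodular_mult)
qed

lemma unimod_equiv_diag:
  assumes "unimod_equiv X Y" and X: "X \<in> carrier_mat r s" and Y: "Y \<in> carrier_mat r s"
    and Z: "Z \<in> carrier_mat r' s'"
  shows "unimod_equiv (four_block_mat X (0\<^sub>m r s') (0\<^sub>m r' s) Z)
    (four_block_mat Y (0\<^sub>m r s') (0\<^sub>m r' s) Z)"
proof -
  obtain U V where UV: "U \<in> carrier_mat r r" "unimodular U"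
      "V \<in> carrier_mat s s" "unimodular V" "U * X * V = Y"
    using unimod_equivE[OF assms(1) X] by metis
  let ?U = "four_block_mat U (0\<^sub>m r r') (0\<^sub>m r' r) (1\<^sub>m r')"
  let ?V = "four_block_mat V (0\<^sub>m s s') (0\<^sub>m s' s) (1\<^sub>m s')"
  have UX: "U * X \<in> carrier_mat r s" using UV X by simp
  have "?U * four_block_mat X (0\<^sub>m r s') (0\<^sub>m r' s) Z =
      four_block_mat (U * X) (0\<^sub>m r s') (0\<^sub>m r' s) Z"
    by (subst mult_four_block_mat[where ?nr1.0=r and ?n1.0=r and ?n2.0=r' and ?nr2.0=r' and ?nc1.0=s and ?nc2.0=s'])
       (use UV X Z in auto)
  also have "\<dots> * ?V = four_block_mat Y (0\<^sub>m r s') (0\<^sub>m r' s) Z"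
    by (subst mult_four_block_mat[where ?nr1.0=r and ?n1.0=s and ?n2.0=s' and ?nr2.0=r' and ?nc1.0=s and ?nc2.0=s'])
       (use UV UX X Y Z in auto)
  finally show ?thesis
    using UV X Z by (intro unimod_equivI[of _ "r + r'" "s + s'" ?U ?V])
      (auto intro: unimodular_diag unimodular_one)
qed

text \<open>The sign of the block permutation depends on r1 and r2. Exhibiting its inverse, the
  opposite swap \<open>?U'\<close>, shows unimodularity without that sign.\<close>

lemma unimod_equiv_swap_rows:
  assumes A: "A \<in> carrier_mat r1 c1" and B: "B \<in> carrier_mat r1 c2"
    and C: "C \<in> carrier_mat r2 c1" and D: "D \<in> carrier_mat r2 c2"
  shows "unimod_equiv (four_block_mat A B C D) (four_block_mat C D A B)"
proof -
  let ?U = "four_block_mat (0\<^sub>m r2 r1) (1\<^sub>m r2) (1\<^sub>m r1) (0\<^sub>m r1 r2) :: 'a poly mat"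
  let ?U' = "four_block_mat (0\<^sub>m r1 r2) (1\<^sub>m r1) (1\<^sub>m r2) (0\<^sub>m r2 r1) :: 'a poly mat"
  have UU: "?U * ?U' = 1\<^sub>m (r1 + r2)"
    by (subst mult_four_block_mat[where ?nr1.0=r2 and ?n1.0=r1 and ?n2.0=r2 and ?nr2.0=r1 and ?nc1.0=r2 and ?nc2.0=r1])
       (auto simp: add.commute)
  have mult: "?U * four_block_mat A B C D = four_block_mat C D A B"
    by (subst mult_four_block_mat[where ?nr1.0=r2 and ?n1.0=r1 and ?n2.0=r2 and ?nr2.0=r1 and ?nc1.0=c1 and ?nc2.0=c2])
       (use A B C D in auto)
  have U: "?U \<in> carrier_mat (r1 + r2) (r1 + r2)" "?U' \<in> carrier_mat (r1 + r2) (r1 + r2)"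
    by (rule carrier_matI; simp)+
  have CD: "four_block_mat C D A B \<in> carrier_mat (r1 + r2) (c1 + c2)"
    using B C by (intro carrier_matI) simp_all
  show ?thesis
  proof (rule unimod_equivI)
    show "four_block_mat A B C D \<in> carrier_mat (r1 + r2) (c1 + c2)"
      using A D by simp
    show "?U * four_block_mat A B C D * 1\<^sub>m (c1 + c2) = four_block_mat C D A B"
      unfolding mult by (rule right_mult_one_mat[OF CD])
  qed (rule U unimodular_if_inverse(1)[OF U UU] unimodular_one one_carrier_mat)+
qed

lemma unimod_equiv_swap_cols:
  assumes A: "A \<in> carrier_mat r1 c1" and B: "B \<in> carrier_mat r1 c2"
    and C: "C \<in> carrier_mat r2 c1" and D: "D \<in> carrier_mat r2 c2"
  shows "unimod_equiv (four_block_mat A B C D) (four_block_mat B A D C)"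
proof -
  let ?V = "four_block_mat (0\<^sub>m c1 c2) (1\<^sub>m c1) (1\<^sub>m c2) (0\<^sub>m c2 c1) :: 'a poly mat"
  let ?V' = "four_block_mat (0\<^sub>m c2 c1) (1\<^sub>m c2) (1\<^sub>m c1) (0\<^sub>m c1 c2) :: 'a poly mat"
  have VV: "?V * ?V' = 1\<^sub>m (c1 + c2)"
    by (subst mult_four_block_mat[where ?nr1.0=c1 and ?n1.0=c2 and ?n2.0=c1 and ?nr2.0=c2 and ?nc1.0=c1 and ?nc2.0=c2])
       (auto simp: add.commute)
  have mult: "four_block_mat A B C D * ?V = four_block_mat B A D C"
    by (subst mult_four_block_mat[where ?nr1.0=r1 and ?n1.0=c1 and ?n2.0=c2 and ?nr2.0=r2 and ?nc1.0=c2 and ?nc2.0=c1])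
       (use A B C D in auto)
  have V: "?V \<in> carrier_mat (c1 + c2) (c1 + c2)" "?V' \<in> carrier_mat (c1 + c2) (c1 + c2)"
    by (rule carrier_matI; simp)+
  have X: "four_block_mat A B C D \<in> carrier_mat (r1 + r2) (c1 + c2)"
    using A D by simp
  show ?thesis
  proof (rule unimod_equivI[OF X])
    show "1\<^sub>m (r1 + r2) * four_block_mat A B C D * ?V = four_block_mat B A D C"
      unfolding left_mult_one_mat[OF X] by (rule mult)
  qed (rule V unimodular_if_inverse(1)[OF V VV] unimodular_one one_carrier_mat)+
qed

text \<open>The left factor clears \<open>B\<close> against the pivot \<open>D\<close>. The right
  factor then clears \<open>C\<close> and at the same time normalizes \<open>D\<close> to the
  identity; this is why its lower right block is \<open>D'\<close>, and its determinant det D' is a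
  unit because \<open>D'\<close> has a polynomial inverse.\<close>

lemma unimod_equiv_Schur:
  fixes A B C D D' :: "'a :: field poly mat"
  assumes A: "A \<in> carrier_mat r c" and B: "B \<in> carrier_mat r k"
    and C: "C \<in> carrier_mat k c" and D: "D \<in> carrier_mat k k" and D': "D' \<in> carrier_mat k k"
    and DD: "D * D' = 1\<^sub>m k" and DD': "D' * D = 1\<^sub>m k"
  shows "unimod_equiv (four_block_mat A B C D)
    (four_block_mat (A - B * D' * C) (0\<^sub>m r k) (0\<^sub>m k c) (1\<^sub>m k))"
proof -
  define E F where "E = - (B * D')" and "F = - (D' * C)"
  have E: "E \<in> carrier_mat r k" and F: "F \<in> carrier_mat k c"
    using B C D' by (auto simp: E_def F_def)
  let ?U = "four_block_mat (1\<^sub>m r) E (0\<^sub>m k r) (1\<^sub>m k)"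
  let ?V = "four_block_mat (1\<^sub>m c) (0\<^sub>m c k) F D'"
  have ED: "E * D = - B"
    using B D D' DD' unfolding E_def by (simp add: assoc_mult_mat[OF B D' D])
  have EC: "A + E * C = A - B * D' * C"
    using A B C D' unfolding E_def by (intro eq_matI) auto
  have DF: "D * F = - C"
    using C D D' DD assoc_mult_mat[OF D D' C] unfolding F_def by simp
  have minus_self: "Z + - Z = 0\<^sub>m a b" if "Z \<in> carrier_mat a b" for Z :: "'a poly mat" and a b
    using that by (intro eq_matI) auto
  have X: "A - B * D' * C \<in> carrier_mat r c"
    using A B C D' by auto
  have "?U * four_block_mat A B C D = four_block_mat (A - B * D' * C) (0\<^sub>m r k) C D"
    unfolding mult_four_block_mat[OF one_carrier_mat E zero_carrier_mat one_carrier_mat A B C D] ED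
      left_mult_one_mat[OF A] left_mult_one_mat[OF B] left_mult_one_mat[OF C]
      left_mult_one_mat[OF D] left_mult_zero_mat[OF A] left_mult_zero_mat[OF B] EC
      minus_self[OF B] left_add_zero_mat[OF C] left_add_zero_mat[OF D] ..
  also have "\<dots> * ?V = four_block_mat (A - B * D' * C) (0\<^sub>m r k) (0\<^sub>m k c) (1\<^sub>m k)"
    unfolding mult_four_block_mat[OF X zero_carrier_mat C D one_carrier_mat zero_carrier_mat F D']
      DF DD right_mult_one_mat[OF X] right_mult_one_mat[OF C] left_mult_zero_mat[OF F]
      left_mult_zero_mat[OF D'] right_mult_zero_mat[OF X] right_mult_zero_mat[OF C]
      minus_self[OF C] right_add_zero_mat[OF X]
      left_add_zero_mat[OF zero_carrier_mat] left_add_zero_mat[OF one_carrier_mat] ..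
  finally have eq: "?U * four_block_mat A B C D * ?V = \<dots>" .
  have "det ?U = 1"
    using det_four_block_mat_lower_left_zero[OF one_carrier_mat E refl one_carrier_mat] by simp
  then have "unimodular ?U"
    using E by (auto simp: unimodular_def intro!: exI[of _ 1])
  moreover have "det ?V = det D'"
    using det_four_block_mat_upper_right_zero[OF one_carrier_mat refl F D'] by simp
  then have "unimodular ?V"
    using unimodular_if_inverse(2)[OF D D' DD] D' by (auto simp: unimodular_def)
  ultimately show ?thesis
    using eq A B C D D' E F by (intro unimod_equivI[of _ "r + k" "c + k" ?U ?V]) auto
qed

text \<open>After the congruence the block rows are [S X 0], [Y Z I], [0 sI 0], of sizes p, k, k.
  The lower right part of size 2k is the pivot, invertible whatever \<open>Z\<close> is, and the
  zero corner of the pencil becomes a zero top left block of its inverse. The Schur correction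
  passes only through that block, so \<open>S\<close> survives unchanged.\<close>

lemma unimod_equiv_bordered:
  fixes M K W \<Lambda> :: "'a :: field poly mat"
  assumes M: "M \<in> carrier_mat (p + k) (p + k)" and K: "K \<in> carrier_mat k (p + k)"
    and W: "W \<in> carrier_mat (p + k) (p + k)" and uni: "unimodular W"
    and \<Lambda>: "\<Lambda> \<in> carrier_mat (p + k) p" and cols: "\<And>j. j < p \<Longrightarrow> col W j = col \<Lambda> j"
    and KW: "K * W = mat k (p + k) (\<lambda>(i, j). if j = i + p then 1 else 0)"
    and s: "s * s = 1"
  shows "unimod_equiv (four_block_mat M (transpose_mat K) (s \<cdot>\<^sub>m K) (0\<^sub>m k k))
    (four_block_mat (transpose_mat \<Lambda> * M * \<Lambda>) (0\<^sub>m p (k + k)) (0\<^sub>m (k + k) p) (1\<^sub>m (k + k)))"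
proof -
  define H where "H = transpose_mat W * M * W"
  define J where "J = K * W"
  have WT: "transpose_mat W \<in> carrier_mat (p + k) (p + k)"
    and WTM: "transpose_mat W * M \<in> carrier_mat (p + k) (p + k)"
    and H: "H \<in> carrier_mat (p + k) (p + k)"
    and J: "J \<in> carrier_mat k (p + k)"
    and KT: "transpose_mat K \<in> carrier_mat (p + k) k"
    and sK: "s \<cdot>\<^sub>m K \<in> carrier_mat k (p + k)"
    and WTK: "transpose_mat W * transpose_mat K \<in> carrier_mat (p + k) k"
    using M K W unfolding H_def J_def by auto
  let ?L = "four_block_mat M (transpose_mat K) (s \<cdot>\<^sub>m K) (0\<^sub>m k k)"
  let ?U = "four_block_mat (transpose_mat W) (0\<^sub>m (p + k) k) (0\<^sub>m k (p + k)) (1\<^sub>m k)"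
  let ?V = "four_block_mat W (0\<^sub>m (p + k) k) (0\<^sub>m k (p + k)) (1\<^sub>m k)"
  have sKW: "s \<cdot>\<^sub>m K * W = s \<cdot>\<^sub>m J"
    unfolding J_def using K W by (rule mult_smult_assoc_mat)
  have sJ: "s \<cdot>\<^sub>m J \<in> carrier_mat k (p + k)"
    using J by simp
  have WKT: "transpose_mat W * transpose_mat K = transpose_mat J"
    unfolding J_def by (rule transpose_mult[OF K W, symmetric])
  have JT: "transpose_mat J \<in> carrier_mat (p + k) k"
    using J by simp
  have UL: "?U * ?L = four_block_mat (transpose_mat W * M) (transpose_mat J) (s \<cdot>\<^sub>m K) (0\<^sub>m k k)"
    unfolding mult_four_block_mat[OF WT zero_carrier_mat zero_carrier_mat one_carrier_mat
        M KT sK zero_carrier_mat] WKT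
    by (rule cong_four_block_mat; use M K JT WTM in simp)
  have ULV: "?U * ?L * ?V = four_block_mat H (transpose_mat J) (s \<cdot>\<^sub>m J) (0\<^sub>m k k)"
    unfolding UL mult_four_block_mat[OF WTM JT sK zero_carrier_mat
        W zero_carrier_mat zero_carrier_mat one_carrier_mat] sKW H_def[symmetric]
    by (intro cong_four_block_mat; use JT sJ H in
      \<open>simp add: right_mult_zero_mat[OF WTM] right_mult_zero_mat[OF sK]\<close>)
  have step1: "unimod_equiv ?L (four_block_mat H (transpose_mat J) (s \<cdot>\<^sub>m J) (0\<^sub>m k k))"
  proof (rule unimod_equivI[OF _ _ _ _ _ ULV])
    show "?L \<in> carrier_mat (p + k + k) (p + k + k)"
      using M by (intro four_block_carrier_mat) auto
    show "?U \<in> carrier_mat (p + k + k) (p + k + k)" "?V \<in> carrier_mat (p + k + k) (p + k + k)"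
      using W by (intro four_block_carrier_mat; simp)+
    show "unimodular ?U" "unimodular ?V"
      by (rule unimodular_diag unimodular_one WT W uni unimodular_transpose[OF W uni] one_carrier_mat)+
  qed
  define X Y Z where "X = mat p k (\<lambda>(i, j). H $$ (i, j + p))"
    and "Y = mat k p (\<lambda>(i, j). H $$ (i + p, j))"
    and "Z = mat k k (\<lambda>(i, j). H $$ (i + p, j + p))"
  have X: "X \<in> carrier_mat p k" and Y: "Y \<in> carrier_mat k p" and Z: "Z \<in> carrier_mat k k"
    by (simp_all add: X_def Y_def Z_def)
  define S where "S = transpose_mat \<Lambda> * M * \<Lambda>"
  have S: "S \<in> carrier_mat p p"
    using \<Lambda> M unfolding S_def by auto
  \<comment> \<open>Entry (i, j) of the congruence involves only columns i and j of
    \<open>W\<close>, and the first p columns of \<open>W\<close> are those of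
    \<open>\<Lambda>\<close>.\<close>
  have HS: "H $$ (i, j) = S $$ (i, j)" if "i < p" "j < p" for i j
    using that M W \<Lambda> cols unfolding H_def S_def
    by (simp add: assoc_mult_mat[of _ p "p + k"] assoc_mult_mat[of _ "p + k" "p + k"] scalar_prod_def)
  \<comment> \<open>In \<open>D'\<close> the block - s Z cancels the product of Z with s I, and s *
    s = 1 makes s its own inverse.\<close>
  define D D' where "D = four_block_mat Z (1\<^sub>m k) (s \<cdot>\<^sub>m 1\<^sub>m k) (0\<^sub>m k k)"
    and "D' = four_block_mat (0\<^sub>m k k) (s \<cdot>\<^sub>m 1\<^sub>m k) (1\<^sub>m k) (- s \<cdot>\<^sub>m Z)"
  \<comment> \<open>Blocks with no rows or no columns turn the row [X 0] and the column [Y; 0] into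
    four-block matrices, so that the block product rule applies.\<close>
  define B C where "B = four_block_mat X (0\<^sub>m p k) (0\<^sub>m 0 k) (0\<^sub>m 0 k)"
    and "C = four_block_mat Y (0\<^sub>m k 0) (0\<^sub>m k p) (0\<^sub>m k 0)"
  have D: "D \<in> carrier_mat (k + k) (k + k)" and D': "D' \<in> carrier_mat (k + k) (k + k)"
    and B: "B \<in> carrier_mat p (k + k)" and C: "C \<in> carrier_mat (k + k) p"
    using X Y Z unfolding D_def D'_def B_def C_def by (auto intro!: carrier_matI)
  \<comment> \<open>One 3 x 3 array of blocks, bracketed as (p + k) + k on the left and as p + (k +
    k) on the right.\<close>
  have regroup: "four_block_mat H (transpose_mat J) (s \<cdot>\<^sub>m J) (0\<^sub>m k k) = four_block_mat S B C D"
  proof (rule eq_matI)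
    fix i j
    assume "i < dim_row (four_block_mat S B C D)" "j < dim_col (four_block_mat S B C D)"
    then have ij: "i < p + k + k" "j < p + k + k"
      using S D by simp_all
    have cases: "l < p \<or> (\<exists>l'<k. l = p + l') \<or> (\<exists>l'<k. l = p + k + l')" if "l < p + k + k" for l
      using that by presburger
    show "four_block_mat H (transpose_mat J) (s \<cdot>\<^sub>m J) (0\<^sub>m k k) $$ (i, j) = four_block_mat S B C D $$ (i, j)"
      using cases[OF ij(1)] cases[OF ij(2)]
      by (elim disjE exE conjE)
        (simp_all add: carrier_matD[OF H] carrier_matD[OF S] HS J_def KW B_def C_def D_def X_def Y_def Z_def add.commute)
  qed (use carrier_matD[OF H] carrier_matD[OF S] carrier_matD[OF D] in simp_all)
  have s1: "s \<cdot>\<^sub>m 1\<^sub>m k \<in> carrier_mat k k" and sZ: "- s \<cdot>\<^sub>m Z \<in> carrier_mat k k"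
    using Z by auto
  have ss: "s \<cdot>\<^sub>m 1\<^sub>m k * (s \<cdot>\<^sub>m 1\<^sub>m k) = 1\<^sub>m k"
    by (rule eq_matI) (auto simp: s mult.assoc[symmetric])
  have DD: "D * D' = 1\<^sub>m (k + k)"
    unfolding D_def D'_def
      mult_four_block_mat[OF Z one_carrier_mat s1 zero_carrier_mat zero_carrier_mat s1 one_carrier_mat sZ]
      four_block_one_mat[symmetric]
    by (rule cong_four_block_mat; use Z s in \<open>auto intro!: eq_matI simp: ss\<close>)
  have DD': "D' * D = 1\<^sub>m (k + k)"
    unfolding D_def D'_def
      mult_four_block_mat[OF zero_carrier_mat s1 one_carrier_mat sZ Z one_carrier_mat s1 zero_carrier_mat]
      four_block_one_mat[symmetric]
    by (rule cong_four_block_mat; use Z s in \<open>auto intro!: eq_matI simp: ss mult.assoc[symmetric]\<close>)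
  have "B * D' * C = 0\<^sub>m p p"
  proof -
    define X' where "X' = X * (s \<cdot>\<^sub>m 1\<^sub>m k) + 0\<^sub>m p k * (- s \<cdot>\<^sub>m Z)"
    have X': "X' \<in> carrier_mat p k"
      using X Z by (simp add: X'_def)
    have "B * D' = four_block_mat (0\<^sub>m p k) X' (0\<^sub>m 0 k) (0\<^sub>m 0 k)"
      unfolding B_def D'_def X'_def mult_four_block_mat[OF X zero_carrier_mat zero_carrier_mat
          zero_carrier_mat zero_carrier_mat s1 one_carrier_mat sZ]
      by (rule cong_four_block_mat; use X Z in \<open>auto intro!: eq_matI\<close>)
    moreover have "four_block_mat (0\<^sub>m p k) X' (0\<^sub>m 0 k) (0\<^sub>m 0 k) * C =
        four_block_mat (0\<^sub>m p p) (0\<^sub>m p 0) (0\<^sub>m 0 p) (0\<^sub>m 0 0)"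
      unfolding C_def mult_four_block_mat[OF zero_carrier_mat X' zero_carrier_mat
          zero_carrier_mat Y zero_carrier_mat zero_carrier_mat zero_carrier_mat]
      by (rule cong_four_block_mat; use X' Y in \<open>auto intro!: eq_matI\<close>)
    ultimately show ?thesis
      unfolding four_block_zero_mat by simp
  qed
  then have "S - B * D' * C = S"
    using S by (intro eq_matI) auto
  then show ?thesis
    using unimod_equiv_trans[OF step1] unimod_equiv_Schur[OF S B C D D' DD DD'] regroup
    unfolding S_def by simp
qed

section \<open>Kronecker products\<close>

lemma kronecker_mat_carrier [simp]:
  "M \<in> carrier_mat a b \<Longrightarrow> N \<in> carrier_mat c d \<Longrightarrow> M \<otimes>\<^sub>K N \<in> carrier_mat (a * c) (b * d)"
  by (simp add: kronecker_mat_def)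

lemma kronecker_mat_index:
  assumes "M \<in> carrier_mat a b" "N \<in> carrier_mat c d" "i < a * c" "j < b * d"
  shows "(M \<otimes>\<^sub>K N) $$ (i, j) = M $$ (i div c, j div d) * N $$ (i mod c, j mod d)"
  using assms by (simp add: kronecker_mat_def)

lemma transpose_kronecker_mat: "transpose_mat M \<otimes>\<^sub>K transpose_mat N = transpose_mat (M \<otimes>\<^sub>K N)"
proof (rule eq_matI)
  fix i j
  assume "i < dim_row (transpose_mat (M \<otimes>\<^sub>K N))" "j < dim_col (transpose_mat (M \<otimes>\<^sub>K N))"
  then have ij: "i < dim_col M * dim_col N" "j < dim_row M * dim_row N"
    by (simp_all add: kronecker_mat_def)
  then have "dim_col N > 0" "dim_row N > 0"
    by (auto intro: Nat.gr0I)
  with ij show "(transpose_mat M \<otimes>\<^sub>K transpose_mat N) $$ (i, j) = transpose_mat (M \<otimes>\<^sub>K N) $$ (i, j)"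
    by (simp add: kronecker_mat_def less_mult_imp_div_less)
qed (simp_all add: kronecker_mat_def)

lemma transpose_kronecker_one:
  "transpose_mat M \<otimes>\<^sub>K 1\<^sub>m n = transpose_mat (M \<otimes>\<^sub>K 1\<^sub>m n)"
  using transpose_kronecker_mat[of M "1\<^sub>m n"] by simp

text \<open>Reindexing by l = u * c + v: each run of c consecutive indices is one value of u. It
  factors the inner sum of a product of Kronecker products.\<close>

lemma sum_lessThan_mult_div_mod:
  "(\<Sum>l<a * c. f (l div c) (l mod c)) = (\<Sum>u<a. \<Sum>v<c. f u v :: 'b :: comm_monoid_add)" for c :: nat
proof (cases "c = 0")
  case False
  have "(\<Sum>l = u * c..<u * c + c. f (l div c) (l mod c)) = (\<Sum>v<c. f u v)" for u :: nat
    using False sum.shift_bounds_nat_ivl[of "\<lambda>l. f (l div c) (l mod c)" 0 "u * c" c]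
    by (simp add: add.commute lessThan_atLeast0)
  then show ?thesis
    unfolding sum.nat_group[symmetric] by simp
qed simp

text \<open>The mixed-product rule. Through it, matrix identities between \<open>e\<close>,
  \<open>w\<close> and \<open>K\<close> pass to their tensor products with I_n.\<close>

lemma kronecker_mat_mult:
  fixes M :: "'a :: comm_semiring_0 mat"
  assumes M: "M \<in> carrier_mat a b" and N: "N \<in> carrier_mat c d"
    and M': "M' \<in> carrier_mat b e" and N': "N' \<in> carrier_mat d f"
  shows "(M \<otimes>\<^sub>K N) * (M' \<otimes>\<^sub>K N') = (M * M') \<otimes>\<^sub>K (N * N')"
proof (rule eq_matI)
  fix i j
  assume "i < dim_row ((M * M') \<otimes>\<^sub>K (N * N'))" "j < dim_col ((M * M') \<otimes>\<^sub>K (N * N'))"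
  then have ij: "i < a * c" "j < e * f"
    using assms by (simp_all add: kronecker_mat_def)
  then have cf: "c > 0" "f > 0"
    by (auto intro: Nat.gr0I)
  note div = less_mult_imp_div_less[OF ij(1)] less_mult_imp_div_less[OF ij(2)]
  have "((M \<otimes>\<^sub>K N) * (M' \<otimes>\<^sub>K N')) $$ (i, j) =
      (\<Sum>l<b * d. (M \<otimes>\<^sub>K N) $$ (i, l) * (M' \<otimes>\<^sub>K N') $$ (l, j))"
    using ij carrier_matD[OF kronecker_mat_carrier[OF M N]]
      carrier_matD[OF kronecker_mat_carrier[OF M' N']]
    by (simp add: scalar_prod_def lessThan_atLeast0)
  also have "\<dots> = (\<Sum>l<b * d. (M $$ (i div c, l div d) * M' $$ (l div d, j div f)) *
      (N $$ (i mod c, l mod d) * N' $$ (l mod d, j mod f)))"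
    using ij by (intro sum.cong refl)
      (simp add: kronecker_mat_index[OF M N] kronecker_mat_index[OF M' N'] ac_simps)
  also have "\<dots> = (\<Sum>u<b. \<Sum>v<d. (M $$ (i div c, u) * M' $$ (u, j div f)) *
      (N $$ (i mod c, v) * N' $$ (v, j mod f)))"
    by (rule sum_lessThan_mult_div_mod)
  also have "\<dots> = (M * M') $$ (i div c, j div f) * (N * N') $$ (i mod c, j mod f)"
    using assms div cf by (simp add: scalar_prod_def lessThan_atLeast0 sum_product)
  also have "\<dots> = ((M * M') \<otimes>\<^sub>K (N * N')) $$ (i, j)"
    using kronecker_mat_index[OF mult_carrier_mat[OF M M'] mult_carrier_mat[OF N N'] ij] by simp
  finally show "((M \<otimes>\<^sub>K N) * (M' \<otimes>\<^sub>K N')) $$ (i, j) = ((M * M') \<otimes>\<^sub>K (N * N')) $$ (i, j)" .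
qed (use assms in \<open>auto simp: kronecker_mat_def\<close>)

lemma div_mod_eq_imp_eq: "i div n = j div n \<Longrightarrow> i mod n = j mod n \<Longrightarrow> i = j" for i j n :: nat
  by (metis div_mult_mod_eq)

lemma kronecker_mat_one:
  "1\<^sub>m a \<otimes>\<^sub>K 1\<^sub>m c = (1\<^sub>m (a * c) :: 'a :: semiring_1 mat)"
proof (cases "c = 0")
  case False
  then show ?thesis
    by (intro eq_matI)
      (auto simp: kronecker_mat_def less_mult_imp_div_less dest: div_mod_eq_imp_eq)
qed (auto simp: kronecker_mat_def)

section \<open>Reversal\<close>

text \<open>No degree bound appears because the definition drops coefficients above g. Reversal is
  thus additive and commutes with constant factors unconditionally; bounds enter only with products
  and changes of grade.\<close>

lemma coeff_rev_poly: "coeff (rev_poly g p) m = (if m \<le> g then coeff p (g - m) else 0)"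
proof -
  have "coeff (rev_poly g p) m = (\<Sum>k\<le>g. if k = g - m \<and> m \<le> g then coeff p k else 0)"
    unfolding rev_poly_def coeff_sum by (intro sum.cong) auto
  also have "\<dots> = (if m \<le> g then coeff p (g - m) else 0)"
    by (auto simp: sum.delta)
  finally show ?thesis .
qed

lemma degree_rev_poly: "degree (rev_poly g p) \<le> g"
  by (rule degree_le) (simp add: coeff_rev_poly)

lemma rev_poly_0 [simp]: "rev_poly g 0 = 0"
  by (simp add: poly_eq_iff coeff_rev_poly)

lemma rev_poly_add: "rev_poly g (p + q) = rev_poly g p + rev_poly g q"
  by (simp add: poly_eq_iff coeff_rev_poly)

lemma rev_poly_sum: "rev_poly g (sum f S) = (\<Sum>x\<in>S. rev_poly g (f x))"
  by (induction S rule: infinite_finite_induct) (auto simp: rev_poly_add)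

lemma rev_poly_const_mult:
  "rev_poly g ([:c:] * p) = [:c:] * rev_poly g p" for c :: "'a :: comm_semiring_0"
  by (simp add: poly_eq_iff coeff_rev_poly)

lemma rev_poly_monom: "k \<le> g \<Longrightarrow> rev_poly g (monom c k) = monom c (g - k)"
  by (auto simp: poly_eq_iff coeff_rev_poly)

lemma rev_poly_eq_monom_mult_reflect_poly:
  fixes p :: "'a :: comm_semiring_1 poly"
  assumes "degree p \<le> g"
  shows "rev_poly g p = monom 1 (g - degree p) * reflect_poly p"
  using assms
  by (auto simp: poly_eq_iff coeff_rev_poly coeff_monom_mult coeff_reflect_poly coeff_eq_0
      intro!: arg_cong[of _ _ "coeff p"])

text \<open>Grades add under multiplication: \<open>reflect_poly\<close> is multiplicative, and the
  missing powers of lambda add up because degrees do. The zero polynomial is split off since there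
  degrees do not add.\<close>

lemma rev_poly_mult:
  fixes p q :: "'a :: field poly"
  assumes "degree p \<le> a" and "degree q \<le> b"
  shows "rev_poly (a + b) (p * q) = rev_poly a p * rev_poly b q"
proof (cases "p = 0 \<or> q = 0")
  case False
  then have "degree (p * q) = degree p + degree q"
    by (simp add: degree_mult_eq)
  moreover have "monom 1 (a + b - (degree p + degree q)) =
      monom 1 (a - degree p) * (monom 1 (b - degree q) :: 'a poly)"
    using assms by (simp add: mult_monom)
  ultimately show ?thesis
    using assms by (simp add: rev_poly_eq_monom_mult_reflect_poly reflect_poly_mult)
qed auto

section \<open>Block reductions\<close>

text \<open>Common ending of both linearizations: \<open>S\<close> is the compressed 2 x 2 block
  matrix and \<open>R\<close> its target. The identity split off from \<open>S\<close> merges with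
  the one of size q, which gives m = n + q in the definition; swapping block rows and columns puts
  \<open>R\<close> last.\<close>

lemma linearizationI:
  fixes L R S :: "'a :: field poly mat"
  assumes grade: "has_grade 1 L"
    and L: "unimod_equiv L (four_block_mat S (0\<^sub>m (n + n) q) (0\<^sub>m q (n + n)) (1\<^sub>m q))"
    and S: "unimod_equiv S (four_block_mat R (0\<^sub>m n n) (0\<^sub>m n n) (1\<^sub>m n))"
    and carrier: "S \<in> carrier_mat (n + n) (n + n)" "R \<in> carrier_mat n n"
  shows "linearization L R"
proof -
  let ?R1 = "four_block_mat R (0\<^sub>m n n) (0\<^sub>m n n) (1\<^sub>m n)"
  let ?m = "n + q"
  have R1: "?R1 \<in> carrier_mat (n + n) (n + n)"
    using carrier by simp
  note L
  also have "unimod_equiv (four_block_mat S (0\<^sub>m (n + n) q) (0\<^sub>m q (n + n)) (1\<^sub>m q))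
      (four_block_mat ?R1 (0\<^sub>m (n + n) q) (0\<^sub>m q (n + n)) (1\<^sub>m q))"
    using S carrier R1 by (intro unimod_equiv_diag) auto
  also have "four_block_mat ?R1 (0\<^sub>m (n + n) q) (0\<^sub>m q (n + n)) (1\<^sub>m q) =
      four_block_mat R (0\<^sub>m n ?m) (0\<^sub>m ?m n) (1\<^sub>m ?m)"
  proof (rule eq_matI)
    fix i j
    assume "i < dim_row (four_block_mat R (0\<^sub>m n ?m) (0\<^sub>m ?m n) (1\<^sub>m ?m))"
      "j < dim_col (four_block_mat R (0\<^sub>m n ?m) (0\<^sub>m ?m n) (1\<^sub>m ?m))"
    then have ij: "i < n + n + q" "j < n + n + q"
      using carrier by simp_all
    have cases: "l < n \<or> (\<exists>l'<n. l = n + l') \<or> (\<exists>l'<q. l = n + n + l')" if "l < n + n + q" for l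
      using that by presburger
    show "four_block_mat ?R1 (0\<^sub>m (n + n) q) (0\<^sub>m q (n + n)) (1\<^sub>m q) $$ (i, j) =
        four_block_mat R (0\<^sub>m n ?m) (0\<^sub>m ?m n) (1\<^sub>m ?m) $$ (i, j)"
      using cases[OF ij(1)] cases[OF ij(2)]
      by (elim disjE exE conjE) (simp_all add: carrier_matD[OF carrier(2)])
  qed (simp_all add: carrier_matD[OF carrier(2)])
  also have "unimod_equiv \<dots> (four_block_mat (0\<^sub>m ?m n) (1\<^sub>m ?m) R (0\<^sub>m n ?m))"
    using carrier by (intro unimod_equiv_swap_rows) auto
  also have "unimod_equiv \<dots> (four_block_mat (1\<^sub>m ?m) (0\<^sub>m ?m n) (0\<^sub>m n ?m) R)"
    using carrier by (intro unimod_equiv_swap_cols) auto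
  \<comment> \<open>\<open>diag_block_mat\<close> recurses down to the empty list and so leaves
    \<open>R\<close> bordered by empty blocks.\<close>
  also have "four_block_mat (1\<^sub>m ?m) (0\<^sub>m ?m n) (0\<^sub>m n ?m) R = diag_block_mat [1\<^sub>m ?m, R]"
  proof -
    have "four_block_mat R (0\<^sub>m n 0) (0\<^sub>m 0 n) (0\<^sub>m 0 0) = R"
      using carrier by (intro eq_matI) auto
    then show ?thesis
      using carrier by (simp add: Let_def)
  qed
  finally show ?thesis
    using grade unfolding linearization_def unimod_equiv_def by blast
qed

text \<open>Used with x = lambda^t. The pivot - P must sit at the lower right for
  \<open>unimod_equiv_Schur\<close>, hence both swaps; its sign turns the subtracted correction into
  + x^2 P.\<close>

lemma unimod_equiv_corner_quadratic:
  fixes P P' Q :: "'a :: field poly mat"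
  assumes P: "P \<in> carrier_mat n n" and P': "P' \<in> carrier_mat n n" and Q: "Q \<in> carrier_mat n n"
    and inv: "P * P' = 1\<^sub>m n" "P' * P = 1\<^sub>m n"
  shows "unimod_equiv (four_block_mat (- P) (x \<cdot>\<^sub>m P) (x \<cdot>\<^sub>m P) Q)
    (four_block_mat (x * x \<cdot>\<^sub>m P + Q) (0\<^sub>m n n) (0\<^sub>m n n) (1\<^sub>m n))"
proof -
  have xP: "x \<cdot>\<^sub>m P \<in> carrier_mat n n" and mP: "- P \<in> carrier_mat n n" and mP': "- P' \<in> carrier_mat n n"
    using P P' by auto
  have "unimod_equiv (four_block_mat (- P) (x \<cdot>\<^sub>m P) (x \<cdot>\<^sub>m P) Q) (four_block_mat (x \<cdot>\<^sub>m P) Q (- P) (x \<cdot>\<^sub>m P))"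
    by (rule unimod_equiv_swap_rows[OF mP xP xP Q])
  also have "unimod_equiv \<dots> (four_block_mat Q (x \<cdot>\<^sub>m P) (x \<cdot>\<^sub>m P) (- P))"
    by (rule unimod_equiv_swap_cols[OF xP Q mP xP])
  also have "unimod_equiv \<dots> (four_block_mat (Q - x \<cdot>\<^sub>m P * - P' * (x \<cdot>\<^sub>m P)) (0\<^sub>m n n) (0\<^sub>m n n) (1\<^sub>m n))"
    using P P' inv by (intro unimod_equiv_Schur[OF Q xP xP mP mP']) auto
  also have "x \<cdot>\<^sub>m P * - P' * (x \<cdot>\<^sub>m P) = - (x * x \<cdot>\<^sub>m P)"
  proof -
    have "x \<cdot>\<^sub>m P * - P' = - (x \<cdot>\<^sub>m 1\<^sub>m n)"
      using P P' inv by (simp add: mult_smult_assoc_mat[OF P P'])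
    then have "x \<cdot>\<^sub>m P * - P' * (x \<cdot>\<^sub>m P) = - (x \<cdot>\<^sub>m (1\<^sub>m n * (x \<cdot>\<^sub>m P)))"
      using P by (simp add: mult_smult_assoc_mat[OF one_carrier_mat xP])
    also have "\<dots> = - (x * x \<cdot>\<^sub>m P)"
      using xP P by (intro eq_matI) (auto simp: mult.assoc)
    finally show ?thesis .
  qed
  also have "Q - - (x * x \<cdot>\<^sub>m P) = x * x \<cdot>\<^sub>m P + Q"
    using P Q by (intro eq_matI) auto
  finally show ?thesis .
qed

text \<open>Used with x = lambda. The block - lambda P has no polynomial inverse when n > 0, so the
  constant block P at the lower left serves as pivot, and a column swap alone brings it into
  place.\<close>

lemma unimod_equiv_corner_linear:
  fixes P P' Q :: "'a :: field poly mat"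
  assumes P: "P \<in> carrier_mat n n" and P': "P' \<in> carrier_mat n n" and Q: "Q \<in> carrier_mat n n"
    and inv: "P * P' = 1\<^sub>m n" "P' * P = 1\<^sub>m n"
  shows "unimod_equiv (four_block_mat (- (x \<cdot>\<^sub>m P)) P P Q)
    (four_block_mat (P + x \<cdot>\<^sub>m Q) (0\<^sub>m n n) (0\<^sub>m n n) (1\<^sub>m n))"
proof -
  have xP: "- (x \<cdot>\<^sub>m P) \<in> carrier_mat n n"
    using P by auto
  have "unimod_equiv (four_block_mat (- (x \<cdot>\<^sub>m P)) P P Q) (four_block_mat P (- (x \<cdot>\<^sub>m P)) Q P)"
    by (rule unimod_equiv_swap_cols[OF xP P P Q])
  also have "unimod_equiv \<dots> (four_block_mat (P - - (x \<cdot>\<^sub>m P) * P' * Q) (0\<^sub>m n n) (0\<^sub>m n n) (1\<^sub>m n))"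
    by (rule unimod_equiv_Schur[OF P xP Q P P' inv])
  also have "- (x \<cdot>\<^sub>m P) * P' * Q = - (x \<cdot>\<^sub>m Q)"
  proof -
    have "- (x \<cdot>\<^sub>m P) * P' = - (x \<cdot>\<^sub>m 1\<^sub>m n)"
      using P P' inv by (simp add: mult_smult_assoc_mat[OF P P'])
    then show ?thesis
      using Q by (simp add: mult_smult_assoc_mat[OF one_carrier_mat Q])
  qed
  also have "P - - (x \<cdot>\<^sub>m Q) = P + x \<cdot>\<^sub>m Q"
    using P Q by (intro eq_matI) auto
  finally show ?thesis .
qed

lemma unimod_equiv_bordered_kronecker:
  fixes M e w \<Lambda> K :: "'a :: field poly mat"
  assumes t: "t \<ge> 1" and M: "M \<in> carrier_mat ((t + 1) * n) ((t + 1) * n)"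
    and K: "K \<in> carrier_mat (t - 1) (t + 1)" and \<Lambda>: "\<Lambda> \<in> carrier_mat (t + 1) 2"
    and e: "e \<in> carrier_mat (t + 1) (t + 1)" and w: "w \<in> carrier_mat (t + 1) (t + 1)"
    and ew: "e * w = 1\<^sub>m (t + 1)"
    and eK: "\<And>i j. i < t - 1 \<Longrightarrow> j \<le> t \<Longrightarrow> e $$ (i + 2, j) = K $$ (i, j)"
    and w\<Lambda>: "\<And>i j. i \<le> t \<Longrightarrow> j < 2 \<Longrightarrow> w $$ (i, j) = \<Lambda> $$ (i, j)"
    and s: "s * s = 1"
  shows "unimod_equiv
    (four_block_mat M (transpose_mat K \<otimes>\<^sub>K 1\<^sub>m n) (s \<cdot>\<^sub>m (K \<otimes>\<^sub>K 1\<^sub>m n)) (0\<^sub>m ((t - 1) * n) ((t - 1) * n)))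
    (four_block_mat ((transpose_mat \<Lambda> \<otimes>\<^sub>K 1\<^sub>m n) * M * (\<Lambda> \<otimes>\<^sub>K 1\<^sub>m n))
      (0\<^sub>m (n + n) ((t - 1) * n + (t - 1) * n)) (0\<^sub>m ((t - 1) * n + (t - 1) * n) (n + n))
      (1\<^sub>m ((t - 1) * n + (t - 1) * n)))"
proof -
  define k where "k = (t - 1) * n"
  have size: "(t + 1) * n = n + n + k" "2 * n = n + n"
    using t by (cases t; simp add: k_def)+
  let ?W = "w \<otimes>\<^sub>K 1\<^sub>m n" and ?\<Lambda> = "\<Lambda> \<otimes>\<^sub>K 1\<^sub>m n" and ?K = "K \<otimes>\<^sub>K 1\<^sub>m n"
  have I: "1\<^sub>m n \<in> carrier_mat n n" by simp
  have W: "?W \<in> carrier_mat (n + n + k) (n + n + k)"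
    and E: "e \<otimes>\<^sub>K 1\<^sub>m n \<in> carrier_mat (n + n + k) (n + n + k)"
    using kronecker_mat_carrier[OF w I] kronecker_mat_carrier[OF e I] unfolding size by auto
  have K': "?K \<in> carrier_mat k (n + n + k)"
    using kronecker_mat_carrier[OF K I] unfolding size k_def[symmetric] .
  have \<Lambda>': "?\<Lambda> \<in> carrier_mat (n + n + k) (n + n)"
    using kronecker_mat_carrier[OF \<Lambda> I] unfolding size .
  have "(e \<otimes>\<^sub>K 1\<^sub>m n) * ?W = 1\<^sub>m (n + n + k)"
    unfolding kronecker_mat_mult[OF e I w I] ew by (simp only: kronecker_mat_one size left_mult_one_mat[OF I])
  then have uni: "unimodular ?W"
    by (rule unimodular_if_inverse(2)[OF E W])
  have cols: "col ?W j = col ?\<Lambda> j" if j: "j < n + n" for j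
  proof (rule eq_vecI)
    fix i assume "i < dim_vec (col ?\<Lambda> j)"
    then have i: "i < (t + 1) * n"
      using \<Lambda>' unfolding size by simp
    have jn: "j < 2 * n" "j < (t + 1) * n" using j unfolding size by simp_all
    have "i div n \<le> t" "j div n < 2"
      using less_mult_imp_div_less[OF i] less_mult_imp_div_less[OF jn(1)] by auto
    then have "?W $$ (i, j) = ?\<Lambda> $$ (i, j)"
      using w\<Lambda> by (simp add: kronecker_mat_index[OF w I i jn(2)] kronecker_mat_index[OF \<Lambda> I i jn(1)])
    then show "col ?W j $ i = col ?\<Lambda> j $ i"
      using i j W \<Lambda>' unfolding size by simp
  qed (use W \<Lambda>' in simp)
  \<comment> \<open>Row i of \<open>K\<close> is row i + 2 of \<open>e\<close>, so K w consists of
    the rows of the identity from index 2 on.\<close>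
  have Kw: "(K * w) $$ (i, j) = (if j = i + 2 then 1 else 0)" if "i < t - 1" "j < t + 1" for i j
  proof -
    have "(K * w) $$ (i, j) = (e * w) $$ (i + 2, j)"
      using that K e w eK by (auto simp: scalar_prod_def intro!: sum.cong)
    then show ?thesis
      using that unfolding ew by auto
  qed
  have KW: "?K * ?W = mat k (n + n + k) (\<lambda>(i, j). if j = i + (n + n) then 1 else 0)"
  proof (rule eq_matI)
    fix i j
    assume "i < dim_row (mat k (n + n + k) (\<lambda>(i, j). if j = i + (n + n) then 1 else 0 :: 'a poly))"
      "j < dim_col (mat k (n + n + k) (\<lambda>(i, j). if j = i + (n + n) then 1 else 0 :: 'a poly))"
    then have ij: "i < (t - 1) * n" "j < (t + 1) * n"
      unfolding size k_def by simp_all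
    then have n: "n > 0" by (auto intro: Nat.gr0I)
    note div = less_mult_imp_div_less[OF ij(1)] less_mult_imp_div_less[OF ij(2)]
    \<comment> \<open>Moving by two block columns is adding 2n to the index: the quotient grows by 2
      and the remainder stays.\<close>
    have eq: "j = i + (n + n) \<longleftrightarrow> j div n = i div n + 2 \<and> j mod n = i mod n"
    proof
      assume "j = i + (n + n)"
      then have "j = i + 2 * n" by simp
      then show "j div n = i div n + 2 \<and> j mod n = i mod n" using n by simp
    next
      assume *: "j div n = i div n + 2 \<and> j mod n = i mod n"
      have "j = j div n * n + j mod n" "i = i div n * n + i mod n" by simp_all
      with * show "j = i + (n + n)" by (metis add.assoc add.commute add_mult_distrib mult_2)
    qed
    have "(?K * ?W) $$ (i, j) = ((K * w) \<otimes>\<^sub>K 1\<^sub>m n) $$ (i, j)"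
      using kronecker_mat_mult[OF K I w I] by simp
    also have "\<dots> = (K * w) $$ (i div n, j div n) * (1\<^sub>m n $$ (i mod n, j mod n))"
      by (rule kronecker_mat_index[OF mult_carrier_mat[OF K w] I ij])
    also have "\<dots> = (if j = i + (n + n) then 1 else 0)"
      unfolding eq using div n by (simp add: Kw)
    finally show "(?K * ?W) $$ (i, j) = mat k (n + n + k) (\<lambda>(i, j). if j = i + (n + n) then 1 else 0) $$ (i, j)"
      using ij unfolding size k_def by simp
  qed (use K' W in auto)
  show ?thesis
    unfolding transpose_kronecker_one k_def[symmetric]
    by (rule unimod_equiv_bordered[OF M[unfolded size] K' W uni \<Lambda>' cols KW s])
qed

section \<open>The dual bases and their reversals\<close>

lemma sum_two_terms:
  fixes f :: "nat \<Rightarrow> 'a :: comm_ring_1"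
  assumes "a < m" "b < m" "a \<noteq> b"
  shows "(\<Sum>l<m. (if l = a then p else if l = b then q else 0) * f l) = p * f a + q * f b"
proof -
  have "(\<Sum>l<m. (if l = a then p else if l = b then q else 0) * f l) =
      (\<Sum>l<m. if l = a then p * f l else 0) + (\<Sum>l<m. if l = b then q * f l else 0)"
    unfolding sum.distrib[symmetric] using assms(3) by (intro sum.cong) auto
  then show ?thesis
    using assms by simp
qed

text \<open>
  The rows of \<open>e\<close> from index 2 on are those of \<open>L_hat t\<close>, and the first two columns of \<open>w\<close> are
  \<open>Lambda_hat t\<close>; the remaining columns of \<open>w\<close> come from the Neumann series
  $(I - \lambda N)^{-1} = \sum_k \lambda^k N^k$ of the nilpotent shift $N$.
\<close>

lemma Lambda_hat_completion:
  fixes t :: nat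
  assumes t: "t \<ge> 1"
  defines "e \<equiv> mat (t + 1) (t + 1) (\<lambda>(i, j).
      if i = 0 then (if j = 0 then 1 else 0)
      else if i = 1 then (if j = t then 1 else 0)
      else (if j = i - 1 then - 1 else if j = i then monom 1 1 else 0)) :: 'a :: field poly mat"
    and "w \<equiv> mat (t + 1) (t + 1) (\<lambda>(i, j).
      if i = 0 \<or> j = 0 then (if i = j then 1 else 0)
      else if j = 1 then monom 1 (t - i)
      else if i < j then - monom 1 (j - 1 - i) else 0)"
  shows "e * w = 1\<^sub>m (t + 1)"
proof (rule eq_matI)
  fix i j
  assume "i < dim_row (1\<^sub>m (t + 1) :: 'a poly mat)" "j < dim_col (1\<^sub>m (t + 1) :: 'a poly mat)"
  then have ij: "i < t + 1" "j < t + 1"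
    by auto
  have entry: "(e * w) $$ (i, j) = (\<Sum>l<t + 1. e $$ (i, l) * w $$ (l, j))"
    using ij by (simp add: e_def w_def scalar_prod_def lessThan_atLeast0)
  consider "i = 0" | "i = 1" | "i \<ge> 2" by linarith
  then show "(e * w) $$ (i, j) = 1\<^sub>m (t + 1) $$ (i, j)"
  proof cases
    case 1
    have "(e * w) $$ (i, j) = (\<Sum>l<t + 1. (if l = 0 then w $$ (l, j) else 0))"
      unfolding entry using ij 1 by (intro sum.cong) (auto simp: e_def)
    then show ?thesis
      using 1 ij by (auto simp: w_def)
  next
    case 2
    \<comment> \<open>Row 1 of \<open>e\<close> selects the last coordinate, where the second column
      of \<open>Lambda_hat t\<close> has lambda^0 = 1 and all other columns of \<open>w\<close>
      vanish.\<close>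
    have "(e * w) $$ (i, j) = (\<Sum>l<t + 1. (if l = t then w $$ (l, j) else 0))"
      unfolding entry using ij 2 by (intro sum.cong) (auto simp: e_def)
    then show ?thesis
      using 2 ij by (auto simp: w_def)
  next
    case 3
    have "(e * w) $$ (i, j) = (\<Sum>l<t + 1. (if l = i - 1 then - 1 else if l = i then monom 1 1 else 0) * w $$ (l, j))"
      unfolding entry using ij 3 by (intro sum.cong) (auto simp: e_def)
    also have "\<dots> = monom 1 1 * w $$ (i, j) - w $$ (i - 1, j)"
      using ij 3 by (subst sum_two_terms) auto
    \<comment> \<open>The two terms cancel above the diagonal and in column 1; on the diagonal only
      - w (i - 1, i) = lambda^0 survives.\<close>
    also have "\<dots> = 1\<^sub>m (t + 1) $$ (i, j)"
      using ij 3 by (auto simp: w_def mult_monom Suc_diff_le[symmetric] Suc_diff_Suc)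
    finally show ?thesis .
  qed
qed (simp_all add: e_def w_def)

text \<open>In the reversed second column the entry 1 has moved from row t to row 1, so row 1 of
  \<open>e\<close> now selects that coordinate. This makes \<open>e\<close> equal to I - lambda N,
  with N the lower shift on the indices 1 to t, and \<open>w\<close> is its Neumann series.\<close>

lemma rev_Lambda_hat_completion:
  fixes t :: nat
  assumes t: "t \<ge> 1"
  defines "e \<equiv> mat (t + 1) (t + 1) (\<lambda>(i, j).
      if i \<le> 1 then (if j = i then 1 else 0)
      else (if j = i - 1 then - monom 1 1 else if j = i then 1 else 0)) :: 'a :: field poly mat"
    and "w \<equiv> mat (t + 1) (t + 1) (\<lambda>(i, j).
      if i = 0 \<or> j = 0 then (if i = j then 1 else 0)
      else if j \<le> i then monom 1 (i - j) else 0)"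
  shows "e * w = 1\<^sub>m (t + 1)"
proof (rule eq_matI)
  fix i j
  assume "i < dim_row (1\<^sub>m (t + 1) :: 'a poly mat)" "j < dim_col (1\<^sub>m (t + 1) :: 'a poly mat)"
  then have ij: "i < t + 1" "j < t + 1"
    by auto
  have entry: "(e * w) $$ (i, j) = (\<Sum>l<t + 1. e $$ (i, l) * w $$ (l, j))"
    using ij by (simp add: e_def w_def scalar_prod_def lessThan_atLeast0)
  show "(e * w) $$ (i, j) = 1\<^sub>m (t + 1) $$ (i, j)"
  proof (cases "i \<le> 1")
    case True
    have "(e * w) $$ (i, j) = (\<Sum>l<t + 1. (if l = i then w $$ (l, j) else 0))"
      unfolding entry using ij True by (intro sum.cong) (auto simp: e_def)
    then show ?thesis
      using True ij t by (auto simp: w_def)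
  next
    case False
    have "(e * w) $$ (i, j) = (\<Sum>l<t + 1. (if l = i - 1 then - monom 1 1 else if l = i then 1 else 0) * w $$ (l, j))"
      unfolding entry using ij False by (intro sum.cong) (auto simp: e_def)
    also have "\<dots> = w $$ (i, j) - monom 1 1 * w $$ (i - 1, j)"
      using ij False by (subst sum_two_terms) auto
    also have "\<dots> = 1\<^sub>m (t + 1) $$ (i, j)"
      using ij False by (auto simp: w_def mult_monom Suc_diff_le[symmetric] Suc_diff_Suc)
    finally show ?thesis .
  qed
qed (simp_all add: e_def w_def)

text \<open>Reversal is multiplicative once grades add, applied to each term of the double sum. Each
  column has its own grade \<open>d j\<close>: with the common grade t - 1 the constant column would
  acquire a factor lambda^(t - 1).\<close>

lemma rev_mat_congruence_index:
  fixes \<Lambda> M :: "'a :: field poly mat"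
  assumes \<Lambda>: "\<Lambda> \<in> carrier_mat a b" and M: "M \<in> carrier_mat a a"
    and \<Lambda>r: "\<Lambda>r = mat a b (\<lambda>(i, j). rev_poly (d j) (\<Lambda> $$ (i, j)))"
    and d: "\<And>i j. i < a \<Longrightarrow> j < b \<Longrightarrow> degree (\<Lambda> $$ (i, j)) \<le> d j"
    and grade: "has_grade g M" and ij: "i < b" "j < b"
  shows "(transpose_mat \<Lambda>r * rev_mat g M * \<Lambda>r) $$ (i, j) =
    rev_poly (d i + g + d j) ((transpose_mat \<Lambda> * M * \<Lambda>) $$ (i, j))"
proof -
  have expand: "(transpose_mat X * Y * X) $$ (i, j) =
      (\<Sum>l<a. (\<Sum>k<a. X $$ (k, i) * Y $$ (k, l)) * X $$ (l, j))"
    if "X \<in> carrier_mat a b" "Y \<in> carrier_mat a a" for X Y :: "'a poly mat"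
    using that ij by (simp add: scalar_prod_def lessThan_atLeast0 del: assoc_mult_mat)
  have M_degree: "degree (M $$ (k, l)) \<le> g" if "k < a" "l < a" for k l
    using grade M that by (auto simp: has_grade_def)
  \<comment> \<open>This bound on the inner sums permits the second use of
    \<open>rev_poly_mult\<close>.\<close>
  have deg: "degree (\<Sum>k<a. \<Lambda> $$ (k, i) * M $$ (k, l)) \<le> d i + g" if "l < a" for l
    using that d ij M_degree
    by (intro degree_sum_le) (auto intro!: order.trans[OF degree_mult_le] add_mono)
  have "(transpose_mat \<Lambda>r * rev_mat g M * \<Lambda>r) $$ (i, j) =
      (\<Sum>l<a. (\<Sum>k<a. rev_poly (d i) (\<Lambda> $$ (k, i)) * rev_poly g (M $$ (k, l))) * rev_poly (d j) (\<Lambda> $$ (l, j)))"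
    using M ij by (subst expand) (simp_all add: \<Lambda>r rev_mat_def)
  also have "\<dots> = (\<Sum>l<a. rev_poly (d i + g) (\<Sum>k<a. \<Lambda> $$ (k, i) * M $$ (k, l)) * rev_poly (d j) (\<Lambda> $$ (l, j)))"
    using d ij M_degree by (simp add: rev_poly_sum rev_poly_mult)
  also have "\<dots> = rev_poly (d i + g + d j) ((transpose_mat \<Lambda> * M * \<Lambda>) $$ (i, j))"
    unfolding expand[OF \<Lambda> M] using d ij deg by (simp add: rev_poly_sum rev_poly_mult)
  finally show ?thesis .
qed

section \<open>Grades and constant matrices\<close>

lemma const_mat_carrier [simp]: "M \<in> carrier_mat a b \<Longrightarrow> const_mat M \<in> carrier_mat a b"
  by (simp add: const_mat_def)

lemma const_mat_mult:
  fixes M N :: "'a :: comm_ring_1 mat"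
  assumes "M \<in> carrier_mat a b" "N \<in> carrier_mat b c"
  shows "const_mat M * const_mat N = const_mat (M * N)"
proof -
  have sum: "(\<Sum>x\<in>A. [:f x:]) = [:sum f A:]" for f :: "nat \<Rightarrow> 'a" and A
    by (induction A rule: infinite_finite_induct) simp_all
  show ?thesis
    using assms by (intro eq_matI) (auto simp: const_mat_def scalar_prod_def sum mult.commute)
qed

lemma const_mat_one: "const_mat (1\<^sub>m n) = (1\<^sub>m n :: 'a :: comm_ring_1 poly mat)"
  by (rule eq_matI) (auto simp: const_mat_def one_pCons)

lemma invertible_const_mat:
  fixes P :: "'a :: comm_ring_1 mat"
  assumes P: "P \<in> carrier_mat n n" and "invertible_mat P"
  obtains P' where "P' \<in> carrier_mat n n" "const_mat P * P' = 1\<^sub>m n" "P' * const_mat P = 1\<^sub>m n"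
proof -
  obtain R where R: "P * R = 1\<^sub>m n" "R * P = 1\<^sub>m (dim_row R)"
    using assms by (auto simp: invertible_mat_def inverts_mat_def)
  \<comment> \<open>\<open>invertible_mat\<close> leaves the shape of \<open>R\<close> open;
    comparing column counts in the two identities recovers it.\<close>
  have "dim_col (P * R) = n" "dim_col (R * P) = dim_row R"
    using R by simp_all
  then have "R \<in> carrier_mat n n"
    using P by (auto intro!: carrier_matI)
  then show ?thesis
    using that[of "const_mat R"] R P by (simp add: const_mat_mult const_mat_one)
qed

lemma pencil_carrier [simp]: "X \<in> carrier_mat a b \<Longrightarrow> Y \<in> carrier_mat a b \<Longrightarrow> pencil X Y \<in> carrier_mat a b"
  by (simp add: pencil_def)

lemma has_grade_pencil:
  assumes "X \<in> carrier_mat a b" "Y \<in> carrier_mat a b"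
  shows "has_grade 1 (pencil X Y)"
  unfolding has_grade_def
proof (intro allI impI)
  fix i j
  assume "i < dim_row (pencil X Y)" "j < dim_col (pencil X Y)"
  then have "pencil X Y $$ (i, j) = [:Y $$ (i, j), X $$ (i, j):]"
    using assms by (simp add: pencil_def const_mat_def monom_altdef)
  then show "degree (pencil X Y $$ (i, j)) \<le> 1"
    by simp
qed

lemma rev_mat_four_block:
  assumes "A \<in> carrier_mat r1 c1" "B \<in> carrier_mat r1 c2" "C \<in> carrier_mat r2 c1" "D \<in> carrier_mat r2 c2"
  shows "rev_mat g (four_block_mat A B C D) =
    four_block_mat (rev_mat g A) (rev_mat g B) (rev_mat g C) (rev_mat g D)"
  using assms by (intro eq_matI) (auto simp: rev_mat_def)

lemma has_grade_four_block:
  assumes "A \<in> carrier_mat r1 c1" "B \<in> carrier_mat r1 c2" "C \<in> carrier_mat r2 c1" "D \<in> carrier_mat r2 c2"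
    and "has_grade g A" "has_grade g B" "has_grade g C" "has_grade g D"
  shows "has_grade g (four_block_mat A B C D)"
  using assms by (auto simp: has_grade_def)

lemma has_grade_rev_mat: "has_grade g (rev_mat g M)"
  by (simp add: has_grade_def rev_mat_def degree_rev_poly)

lemma rev_mat_kronecker_one:
  "rev_mat g (M \<otimes>\<^sub>K 1\<^sub>m n) = rev_mat g M \<otimes>\<^sub>K (1\<^sub>m n :: 'a :: comm_semiring_1 poly mat)"
proof (cases "n = 0")
  case False
  then show ?thesis
    by (intro eq_matI) (auto simp: rev_mat_def kronecker_mat_def less_mult_imp_div_less)
qed (auto simp: rev_mat_def kronecker_mat_def)

lemma has_grade_kronecker_one:
  assumes "has_grade g M"
  shows "has_grade g (M \<otimes>\<^sub>K (1\<^sub>m n :: 'a :: comm_semiring_1 poly mat))"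
proof (cases "n = 0")
  case False
  then show ?thesis
    using assms by (auto simp: has_grade_def kronecker_mat_def less_mult_imp_div_less)
qed (auto simp: has_grade_def kronecker_mat_def)

section \<open>The strong linearization\<close>

lemma rev_poly_uminus: "rev_poly g (- p) = - rev_poly g p" for p :: "'a :: ab_group_add poly"
  by (simp add: poly_eq_iff coeff_rev_poly)

text \<open>Raising the grade by one costs a factor lambda. This is how Q, of grade 2t - 1, enters
  the reversal of grade 2t as lambda times its own reversal.\<close>

lemma rev_poly_Suc:
  fixes p :: "'a :: comm_semiring_1 poly"
  assumes "degree p \<le> g"
  shows "rev_poly (Suc g) p = monom 1 1 * rev_poly g p"
  using assms by (auto simp: poly_eq_iff coeff_rev_poly coeff_monom_mult coeff_eq_0 Suc_diff_le
      not_le not_less_eq_eq intro!: arg_cong[of _ _ "coeff p"])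

lemma L_hat_carrier: "L_hat t \<in> carrier_mat (t - 1) (t + 1)"
  by (simp add: L_hat_def)

lemma Lambda_hat_carrier: "Lambda_hat t \<in> carrier_mat (t + 1) 2"
  by (simp add: Lambda_hat_def)

lemma has_grade_L_hat: "has_grade 1 (L_hat t)"
  by (auto simp: has_grade_def L_hat_def degree_monom_le)

text \<open>
  Column-wise grades: \<open>rev_Lambda_hat t\<close> has columns $(1, 0, \ldots, 0)$ and
  $(0, 1, \lambda, \ldots, \lambda^{t-1})$.
\<close>

definition Lambda_hat_grade :: "nat \<Rightarrow> nat \<Rightarrow> nat" where
  "Lambda_hat_grade t j = (if j = 0 then 0 else t - 1)"

definition rev_Lambda_hat :: "nat \<Rightarrow> 'a :: comm_semiring_1 poly mat" where
  "rev_Lambda_hat t = mat (t + 1) 2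
     (\<lambda>(i, j). rev_poly (Lambda_hat_grade t j) (Lambda_hat t $$ (i, j)))"

lemma degree_Lambda_hat:
  assumes "i < t + 1" "j < 2"
  shows "degree (Lambda_hat t $$ (i, j) :: 'a :: comm_semiring_1 poly) \<le> Lambda_hat_grade t j"
  using assms degree_monom_le[of "1 :: 'a" "t - i"]
  by (auto simp: Lambda_hat_def Lambda_hat_grade_def)

lemma unimod_equiv_L_hat:
  fixes M :: "'a :: field poly mat"
  assumes t: "t \<ge> 1" and M: "M \<in> carrier_mat ((t + 1) * n) ((t + 1) * n)" and s: "s * s = 1"
  shows "unimod_equiv
    (four_block_mat M (transpose_mat (L_hat t) \<otimes>\<^sub>K 1\<^sub>m n) (s \<cdot>\<^sub>m (L_hat t \<otimes>\<^sub>K 1\<^sub>m n))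
      (0\<^sub>m ((t - 1) * n) ((t - 1) * n)))
    (four_block_mat ((transpose_mat (Lambda_hat t) \<otimes>\<^sub>K 1\<^sub>m n) * M * (Lambda_hat t \<otimes>\<^sub>K 1\<^sub>m n))
      (0\<^sub>m (n + n) ((t - 1) * n + (t - 1) * n)) (0\<^sub>m ((t - 1) * n + (t - 1) * n) (n + n))
      (1\<^sub>m ((t - 1) * n + (t - 1) * n)))"
  by (rule unimod_equiv_bordered_kronecker[OF t M L_hat_carrier Lambda_hat_carrier _ _
        Lambda_hat_completion[OF t] _ _ s])
    (use t in \<open>auto simp: L_hat_def Lambda_hat_def\<close>)

lemma unimod_equiv_rev_L_hat:
  fixes M :: "'a :: field poly mat"
  assumes t: "t \<ge> 1" and M: "M \<in> carrier_mat ((t + 1) * n) ((t + 1) * n)" and s: "s * s = 1"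
  shows "unimod_equiv
    (four_block_mat M (transpose_mat (rev_mat 1 (L_hat t)) \<otimes>\<^sub>K 1\<^sub>m n) (s \<cdot>\<^sub>m (rev_mat 1 (L_hat t) \<otimes>\<^sub>K 1\<^sub>m n))
      (0\<^sub>m ((t - 1) * n) ((t - 1) * n)))
    (four_block_mat ((transpose_mat (rev_Lambda_hat t) \<otimes>\<^sub>K 1\<^sub>m n) * M * (rev_Lambda_hat t \<otimes>\<^sub>K 1\<^sub>m n))
      (0\<^sub>m (n + n) ((t - 1) * n + (t - 1) * n)) (0\<^sub>m ((t - 1) * n + (t - 1) * n) (n + n))
      (1\<^sub>m ((t - 1) * n + (t - 1) * n)))"
proof -
  have one: "rev_poly 1 (1 :: 'a poly) = monom 1 1" "rev_poly 0 (1 :: 'a poly) = 1"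
    "rev_poly 1 (monom 1 1 :: 'a poly) = 1"
    using rev_poly_monom[of 0 1 "1 :: 'a"] rev_poly_monom[of 0 0 "1 :: 'a"] rev_poly_monom[of 1 1 "1 :: 'a"]
    by simp_all
  have K: "rev_mat 1 (L_hat t) \<in> carrier_mat (t - 1) (t + 1)"
    by (simp add: rev_mat_def L_hat_def)
  have \<Lambda>: "rev_Lambda_hat t \<in> carrier_mat (t + 1) 2"
    by (simp add: rev_Lambda_hat_def)
  show ?thesis
    by (rule unimod_equiv_bordered_kronecker[OF t M K \<Lambda> _ _ rev_Lambda_hat_completion[OF t] _ _ s])
      (use t in \<open>auto simp: rev_mat_def L_hat_def rev_Lambda_hat_def Lambda_hat_def Lambda_hat_grade_def
          less_2_cases_iff rev_poly_uminus one[simplified] rev_poly_monom\<close>)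
qed

text \<open>The blocks are reversed with grades 1, t, t and 2t - 1. As P is constant, - P becomes -
  lambda P while lambda^t P becomes P.\<close>

lemma rev_mat_Lambda_hat_congruence:
  fixes M P Q :: "'a :: field poly mat"
  assumes t: "t \<ge> 1" and M: "M \<in> carrier_mat ((t + 1) * n) ((t + 1) * n)" and grade: "has_grade 1 M"
    and P: "P \<in> carrier_mat n n" "has_grade 0 P" and Q: "Q \<in> carrier_mat n n"
    and eq: "(transpose_mat (Lambda_hat t) \<otimes>\<^sub>K 1\<^sub>m n) * M * (Lambda_hat t \<otimes>\<^sub>K 1\<^sub>m n) =
      four_block_mat (- P) (monom 1 t \<cdot>\<^sub>m P) (monom 1 t \<cdot>\<^sub>m P) Q"
  shows "(transpose_mat (rev_Lambda_hat t) \<otimes>\<^sub>K 1\<^sub>m n) * rev_mat 1 M * (rev_Lambda_hat t \<otimes>\<^sub>K 1\<^sub>m n) =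
    four_block_mat (- (monom 1 1 \<cdot>\<^sub>m P)) P P (rev_mat (2 * t - 1) Q)"
proof (rule eq_matI)
  have I: "1\<^sub>m n \<in> carrier_mat n n" by simp
  let ?d = "\<lambda>j. Lambda_hat_grade t (j div n)"
  let ?\<Lambda> = "Lambda_hat t \<otimes>\<^sub>K 1\<^sub>m n :: 'a poly mat"
  have r\<Lambda>: "rev_Lambda_hat t \<in> carrier_mat (t + 1) 2"
    by (simp add: rev_Lambda_hat_def)
  have \<Lambda>: "?\<Lambda> \<in> carrier_mat ((t + 1) * n) (2 * n)"
    by (rule kronecker_mat_carrier[OF Lambda_hat_carrier I])
  have entry: "?\<Lambda> $$ (i, j) = (if i mod n = j mod n then Lambda_hat t $$ (i div n, j div n) else 0)"
    and small: "i div n < t + 1" "j div n < 2"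
    if "i < (t + 1) * n" "j < 2 * n" for i j
  proof -
    have "n > 0" using that(2) by (auto intro: Nat.gr0I)
    then show "?\<Lambda> $$ (i, j) = (if i mod n = j mod n then Lambda_hat t $$ (i div n, j div n) else 0)"
      by (simp add: kronecker_mat_index[OF Lambda_hat_carrier I that])
    show "i div n < t + 1" "j div n < 2"
      using that by (auto intro: less_mult_imp_div_less)
  qed
  have rev: "rev_Lambda_hat t \<otimes>\<^sub>K 1\<^sub>m n = mat ((t + 1) * n) (2 * n) (\<lambda>(i, j). rev_poly (?d j) (?\<Lambda> $$ (i, j)))"
  proof (rule eq_matI)
    fix i j
    assume "i < dim_row (mat ((t + 1) * n) (2 * n) (\<lambda>(i, j). rev_poly (?d j) (?\<Lambda> $$ (i, j))))"
      "j < dim_col (mat ((t + 1) * n) (2 * n) (\<lambda>(i, j). rev_poly (?d j) (?\<Lambda> $$ (i, j))))"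
    then have ij: "i < (t + 1) * n" "j < 2 * n" by simp_all
    then have "n > 0" by (auto intro: Nat.gr0I)
    then show "(rev_Lambda_hat t \<otimes>\<^sub>K 1\<^sub>m n) $$ (i, j) =
        mat ((t + 1) * n) (2 * n) (\<lambda>(i, j). rev_poly (?d j) (?\<Lambda> $$ (i, j))) $$ (i, j)"
      using ij small[OF ij]
      by (simp add: kronecker_mat_index[OF r\<Lambda> I ij] entry[OF ij]) (simp add: rev_Lambda_hat_def)
  qed (simp_all add: kronecker_mat_def rev_Lambda_hat_def)
  have deg: "degree (?\<Lambda> $$ (i, j)) \<le> ?d j" if "i < (t + 1) * n" "j < 2 * n" for i j
    using entry[OF that] degree_Lambda_hat[OF small[OF that], where 'a = 'a] by simp
  fix i j
  assume "i < dim_row (four_block_mat (- (monom 1 1 \<cdot>\<^sub>m P)) P P (rev_mat (2 * t - 1) Q))"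
    "j < dim_col (four_block_mat (- (monom 1 1 \<cdot>\<^sub>m P)) P P (rev_mat (2 * t - 1) Q))"
  then have ij: "i < 2 * n" "j < 2 * n"
    using P Q by (simp_all add: rev_mat_def)
  \<comment> \<open>Indices below n belong to the constant column of the dual basis, the remaining
    ones to the column of powers.\<close>
  have blocks: "l < n \<and> ?d l = 0 \<or> (\<exists>l'<n. l = n + l' \<and> ?d l = t - 1)" if "l < 2 * n" for l
  proof (cases "l < n")
    case False
    then have "l = n + (l - n)" "l - n < n" using that by auto
    then have "l div n = 1" by (metis div_add_self1 div_less add.commute add_0 less_nat_zero_code)
    with \<open>l = n + (l - n)\<close> \<open>l - n < n\<close> show ?thesis
      by (auto simp: Lambda_hat_grade_def intro!: exI[of _ "l - n"])
  qed (simp add: Lambda_hat_grade_def)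
  have P_rev: "rev_poly 1 (- (P $$ (k, l))) = - (monom 1 1 * P $$ (k, l))"
    "rev_poly t (monom 1 t * P $$ (k, l)) = P $$ (k, l)" if "k < n" "l < n" for k l
  proof -
    have "degree (P $$ (k, l)) = 0"
      using P that by (auto simp: has_grade_def)
    then obtain c where c: "P $$ (k, l) = [:c:]"
      by (rule degree_eq_zeroE)
    then have m: "P $$ (k, l) = monom c 0"
      by (simp add: monom_0)
    show "rev_poly 1 (- (P $$ (k, l))) = - (monom 1 1 * P $$ (k, l))"
      unfolding m rev_poly_uminus by (simp add: rev_poly_monom mult_monom)
    show "rev_poly t (monom 1 t * P $$ (k, l)) = P $$ (k, l)"
      unfolding m by (simp add: rev_poly_monom mult_monom)
  qed
  have sums: "t - Suc 0 + Suc 0 = t" "Suc (t - Suc 0) = t" "t + (t - Suc 0) = 2 * t - Suc 0"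
    using t by simp_all
  have "((transpose_mat (rev_Lambda_hat t) \<otimes>\<^sub>K 1\<^sub>m n) * rev_mat 1 M * (rev_Lambda_hat t \<otimes>\<^sub>K 1\<^sub>m n)) $$ (i, j) =
      rev_poly (?d i + 1 + ?d j) (four_block_mat (- P) (monom 1 t \<cdot>\<^sub>m P) (monom 1 t \<cdot>\<^sub>m P) Q $$ (i, j))"
    unfolding transpose_kronecker_one eq[symmetric] by (rule rev_mat_congruence_index[OF \<Lambda> M rev deg grade ij])
  also have "\<dots> = four_block_mat (- (monom 1 1 \<cdot>\<^sub>m P)) P P (rev_mat (2 * t - 1) Q) $$ (i, j)"
    using blocks[OF ij(1)] blocks[OF ij(2)]
    by (elim disjE exE conjE)
      (simp_all add: carrier_matD[OF P(1)] carrier_matD[OF Q] rev_mat_def sums P_rev[simplified])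
  finally show "((transpose_mat (rev_Lambda_hat t) \<otimes>\<^sub>K 1\<^sub>m n) * rev_mat 1 M * (rev_Lambda_hat t \<otimes>\<^sub>K 1\<^sub>m n)) $$ (i, j) =
      four_block_mat (- (monom 1 1 \<cdot>\<^sub>m P)) P P (rev_mat (2 * t - 1) Q) $$ (i, j)" .
qed (use P Q in \<open>auto simp: kronecker_mat_def rev_Lambda_hat_def rev_mat_def\<close>)

theorem theorem5p6:
  fixes A B P :: "'a :: field mat"
    and Q :: "'a poly mat"
    and \<sigma> :: 'a
    and t n :: nat
  assumes "t \<ge> 1" and "n \<ge> 1"
    and "\<sigma> \<in> {1, -1}"
    and "A \<in> carrier_mat ((t + 1) * n) ((t + 1) * n)"
    and "B \<in> carrier_mat ((t + 1) * n) ((t + 1) * n)"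
    and "P \<in> carrier_mat n n" and "invertible_mat P"
    and "Q \<in> carrier_mat n n" and "has_grade (2 * t - 1) Q"
    and "(transpose_mat (Lambda_hat t) \<otimes>\<^sub>K 1\<^sub>m n) * pencil B A * (Lambda_hat t \<otimes>\<^sub>K 1\<^sub>m n) =
      four_block_mat
        (- const_mat P) (monom 1 t \<cdot>\<^sub>m const_mat P)
        (monom 1 t \<cdot>\<^sub>m const_mat P) Q"
  shows "strong_linearization
      (four_block_mat
        (pencil B A) (transpose_mat (L_hat t) \<otimes>\<^sub>K 1\<^sub>m n)
        ([:\<sigma>:] \<cdot>\<^sub>m L_hat t \<otimes>\<^sub>K 1\<^sub>m n) (0\<^sub>m ((t - 1) * n) ((t - 1) * n)))
      (2 * t)
      (monom 1 (2 * t) \<cdot>\<^sub>m const_mat P + Q)"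
proof -
  note t = assms(1) and A = assms(4) and B = assms(5) and P = assms(6) and Q = assms(8) and gQ = assms(9)
    and eq = assms(10)
  let ?P = "const_mat P" and ?M = "pencil B A" and ?K = "L_hat t :: 'a poly mat"
  let ?R = "monom 1 (2 * t) \<cdot>\<^sub>m ?P + Q"
  let ?k = "(t - 1) * n"
  \<comment> \<open>As a constant polynomial, sigma squares to 1 for either sign and in every
    characteristic; the reduction relies on nothing else about it.\<close>
  define s where "s = [:\<sigma>:]"
  have s: "s * s = 1"
    using assms(3) by (auto simp: s_def one_pCons)
  obtain P' where P': "P' \<in> carrier_mat n n" "?P * P' = 1\<^sub>m n" "P' * ?P = 1\<^sub>m n"
    using invertible_const_mat[OF P assms(7)] .
  have Pc: "?P \<in> carrier_mat n n"
    using P by simp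
  have M: "?M \<in> carrier_mat ((t + 1) * n) ((t + 1) * n)"
    using A B by simp
  have gM: "has_grade 1 ?M"
    by (rule has_grade_pencil[OF B A])
  have R: "?R \<in> carrier_mat n n"
    using Pc Q by simp
  have I: "1\<^sub>m n \<in> carrier_mat n n"
    by simp
  have K: "?K \<otimes>\<^sub>K 1\<^sub>m n \<in> carrier_mat ?k ((t + 1) * n)"
    by (rule kronecker_mat_carrier[OF L_hat_carrier I])
  have KT: "transpose_mat ?K \<otimes>\<^sub>K 1\<^sub>m n \<in> carrier_mat ((t + 1) * n) ?k"
    unfolding transpose_kronecker_one using K by simp
  have sK: "s \<cdot>\<^sub>m (?K \<otimes>\<^sub>K 1\<^sub>m n) \<in> carrier_mat ?k ((t + 1) * n)"
    using K by simp
  let ?L = "four_block_mat ?M (transpose_mat ?K \<otimes>\<^sub>K 1\<^sub>m n) (s \<cdot>\<^sub>m (?K \<otimes>\<^sub>K 1\<^sub>m n)) (0\<^sub>m ?k ?k)"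
  have gK: "has_grade 1 (?K \<otimes>\<^sub>K 1\<^sub>m n)"
    by (rule has_grade_kronecker_one[OF has_grade_L_hat])
  have gKT: "has_grade 1 (transpose_mat ?K \<otimes>\<^sub>K 1\<^sub>m n)"
    unfolding transpose_kronecker_one using gK by (auto simp: has_grade_def)
  have gsK: "has_grade 1 (s \<cdot>\<^sub>m (?K \<otimes>\<^sub>K 1\<^sub>m n))"
    using gK by (auto simp: has_grade_def s_def intro: order.trans[OF degree_smult_le])
  have gL: "has_grade 1 ?L"
    using gM gKT gsK by (intro has_grade_four_block[OF M KT sK zero_carrier_mat]) (simp_all add: has_grade_def)
  have P_deg: "degree (?P $$ (i, j)) = 0" if "i < n" "j < n" for i j
    using that P by (simp add: const_mat_def)
  then have gP: "has_grade 0 ?P"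
    using Pc by (simp add: has_grade_def)
  have gR: "has_grade (2 * t) ?R"
    unfolding has_grade_def
  proof (intro allI impI)
    fix i j
    assume "i < dim_row ?R" "j < dim_col ?R"
    then have ij: "i < n" "j < n"
      using R by auto
    have "degree (monom 1 (2 * t) * ?P $$ (i, j)) \<le> 2 * t"
      using degree_mult_le[of "monom 1 (2 * t)" "?P $$ (i, j)"] degree_monom_le[of "1 :: 'a" "2 * t"] P_deg[OF ij]
      by simp
    moreover have "degree (Q $$ (i, j)) \<le> 2 * t"
      using gQ Q ij by (force simp: has_grade_def)
    ultimately show "degree (?R $$ (i, j)) \<le> 2 * t"
      using ij Pc Q by (simp add: degree_add_le)
  qed
  have lin: "linearization ?L ?R"
  proof (rule linearizationI[OF gL unimod_equiv_L_hat[OF t M s]])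
    have "monom 1 t * monom 1 t = (monom 1 (2 * t) :: 'a poly)"
      by (simp add: mult_monom mult_2)
    then show "unimod_equiv ((transpose_mat (Lambda_hat t) \<otimes>\<^sub>K 1\<^sub>m n) * ?M * (Lambda_hat t \<otimes>\<^sub>K 1\<^sub>m n))
        (four_block_mat ?R (0\<^sub>m n n) (0\<^sub>m n n) (1\<^sub>m n))"
      unfolding eq using unimod_equiv_corner_quadratic[OF Pc P'(1) Q P'(2,3), of "monom 1 t"] by simp
    show "(transpose_mat (Lambda_hat t) \<otimes>\<^sub>K 1\<^sub>m n) * ?M * (Lambda_hat t \<otimes>\<^sub>K 1\<^sub>m n) \<in> carrier_mat (n + n) (n + n)"
      unfolding eq using Pc Q by (intro four_block_carrier_mat) auto
  qed (rule R)
  \<comment> \<open>Reversal acts entrywise, so it commutes with blocks, transposition, constant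
    factors and tensoring with I_n. The reversed pencil is again bordered, with the reversed
    \<open>L_hat t\<close>.\<close>
  have revL: "rev_mat 1 ?L = four_block_mat (rev_mat 1 ?M) (transpose_mat (rev_mat 1 ?K) \<otimes>\<^sub>K 1\<^sub>m n)
      (s \<cdot>\<^sub>m (rev_mat 1 ?K \<otimes>\<^sub>K 1\<^sub>m n)) (0\<^sub>m ?k ?k)"
  proof -
    have "rev_mat 1 (transpose_mat ?K) = transpose_mat (rev_mat 1 ?K)"
      by (rule eq_matI) (auto simp: rev_mat_def)
    moreover have "rev_mat 1 (s \<cdot>\<^sub>m X) = s \<cdot>\<^sub>m rev_mat 1 X" for X
      unfolding s_def rev_mat_def by (rule eq_matI) (simp_all only: index_map_mat index_smult_mat rev_poly_const_mult)
    moreover have "rev_mat 1 (0\<^sub>m ?k ?k) = (0\<^sub>m ?k ?k :: 'a poly mat)"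
      by (rule eq_matI) (auto simp: rev_mat_def)
    ultimately show ?thesis
      unfolding rev_mat_four_block[OF M KT sK zero_carrier_mat] by (simp only: rev_mat_kronecker_one)
  qed
  have revM: "rev_mat 1 ?M \<in> carrier_mat ((t + 1) * n) ((t + 1) * n)"
    using M by (simp add: rev_mat_def)
  have revQ: "rev_mat (2 * t - 1) Q \<in> carrier_mat n n"
    using Q by (simp add: rev_mat_def)
  \<comment> \<open>At grade 2t the term lambda^(2t) P reverses to P, and Q contributes one extra
    factor lambda.\<close>
  have revR: "rev_mat (2 * t) ?R = ?P + monom 1 1 \<cdot>\<^sub>m rev_mat (2 * t - 1) Q"
  proof (rule eq_matI)
    fix i j
    assume "i < dim_row (?P + monom 1 1 \<cdot>\<^sub>m rev_mat (2 * t - 1) Q)"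
      "j < dim_col (?P + monom 1 1 \<cdot>\<^sub>m rev_mat (2 * t - 1) Q)"
    then have ij: "i < n" "j < n"
      using revQ by auto
    have "degree (Q $$ (i, j)) \<le> 2 * t - 1"
      using gQ Q ij by (auto simp: has_grade_def)
    from rev_poly_Suc[OF this] have 1: "rev_poly (2 * t) (Q $$ (i, j)) = monom 1 1 * rev_poly (2 * t - 1) (Q $$ (i, j))"
      using t by simp
    have "?P $$ (i, j) = monom (P $$ (i, j)) 0"
      using P ij by (simp add: const_mat_def monom_0)
    then have 2: "rev_poly (2 * t) (monom 1 (2 * t) * ?P $$ (i, j)) = ?P $$ (i, j)"
      by (simp add: mult_monom rev_poly_monom)
    show "rev_mat (2 * t) ?R $$ (i, j) = (?P + monom 1 1 \<cdot>\<^sub>m rev_mat (2 * t - 1) Q) $$ (i, j)"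
      using ij Pc Q 1 2 by (simp add: rev_mat_def rev_poly_add)
  qed (use Pc Q in \<open>auto simp: rev_mat_def\<close>)
  note rev_eq = rev_mat_Lambda_hat_congruence[OF t M gM Pc gP Q eq]
  have "linearization (rev_mat 1 ?L) (rev_mat (2 * t) ?R)"
  proof (rule linearizationI[OF has_grade_rev_mat])
    show "unimod_equiv (rev_mat 1 ?L) (four_block_mat
        ((transpose_mat (rev_Lambda_hat t) \<otimes>\<^sub>K 1\<^sub>m n) * rev_mat 1 ?M * (rev_Lambda_hat t \<otimes>\<^sub>K 1\<^sub>m n))
        (0\<^sub>m (n + n) (?k + ?k)) (0\<^sub>m (?k + ?k) (n + n)) (1\<^sub>m (?k + ?k)))"
      unfolding revL by (rule unimod_equiv_rev_L_hat[OF t revM s])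
    show "unimod_equiv ((transpose_mat (rev_Lambda_hat t) \<otimes>\<^sub>K 1\<^sub>m n) * rev_mat 1 ?M * (rev_Lambda_hat t \<otimes>\<^sub>K 1\<^sub>m n))
        (four_block_mat (rev_mat (2 * t) ?R) (0\<^sub>m n n) (0\<^sub>m n n) (1\<^sub>m n))"
      unfolding rev_eq revR by (rule unimod_equiv_corner_linear[OF Pc P'(1) revQ P'(2,3)])
    show "(transpose_mat (rev_Lambda_hat t) \<otimes>\<^sub>K 1\<^sub>m n) * rev_mat 1 ?M * (rev_Lambda_hat t \<otimes>\<^sub>K 1\<^sub>m n) \<in> carrier_mat (n + n) (n + n)"
      unfolding rev_eq using Pc revQ by (intro four_block_carrier_mat) auto
    show "rev_mat (2 * t) ?R \<in> carrier_mat n n"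
      using R by (simp add: rev_mat_def)
  qed
  with gR lin show ?thesis
    unfolding strong_linearization_def s_def by blast
qed

end
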